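(* Let $k$ be a non-archimedean local field, let $G$ be a closed subgroup of $\operatorname{GL}_2(k)$ that contains $\operatorname{SL}_2(k)$, and let $\pi$ be a smooth (complex) representation of $G$. Let $\ell = m..n$ be a segment with $\#\ell - 1 = |m-n| \geq 3$. Then $$e_\ell^* := e_{m..n} - e_{m+1..n} - e_{m..n-1} + e_{m+1..n-1}$$ is the standard projector onto $\pi[\ell]^\sharp$.
   Context: Let $\mathfrak{o}$ be the ring of integers of $k$ and $\mathfrak{p}$ its maximal ideal. $G$ is equipped with a Haar measure $dg$. A segment is a nonempty finite set of consecutive integers $m..n := \{m, m+1, \dots, n\}$, with integers $m\le n$; $\#\ell$ denotes the cardinality of a segment $\ell$. For a segment $\ell = m..n$ let $R_\ell := \begin{bmatrix}\mathfrak{o} & \mathfrak{p}^{-m}\\ \mathfrak{p}^{n} & \mathfrak{o}\end{bmatrix}$ be the corresponding order in $M_2(k)$ (matrices with entries in the indicated sets), $R_\ell^\times$ its unit group, and $K_\ell := R_\ell^\times\cap G$. For $f\in C_c^\infty(G)$, $\pi(f)v := \int_G f(g)\pi(g)v\,dg$. For a segment $\ell$, $\pi[\ell] := \pi^{K_\ell}$ is the subspace of $K_\ell$-fixed vectors and $e_\ell := \pi(\operatorname{vol}(K_\ell)^{-1}1_{K_\ell})\in\operatorname{End}(\pi)$ is the averaging operator over $K_\ell$, an idempotent with image $\pi[\ell]$; thus $\pi = \pi[\ell]\oplus\ker(e_\ell)$. Set $\pi[\ell]^\flat := \sum_{\ell'\subsetneq\ell}\pi[\ell']$ (sum over all proper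 subsegments $\ell'$ of $\ell$) and $\pi[\ell]^\sharp := \{v\in\pi[\ell] : e_{\ell'}v = 0 \text{ for all segments } \ell'\subsetneq\ell\}$. One has $\pi[\ell] = \pi[\ell]^\sharp\oplus\pi[\ell]^\flat$. The standard projector onto $\pi[\ell]^\sharp$ is the projector $\pi\to\pi[\ell]^\sharp$ afforded by the decomposition $\pi = \pi[\ell]^\sharp\oplus\pi[\ell]^\flat\oplus\ker(e_\ell)$, i.e. the operator that is the identity on $\pi[\ell]^\sharp$ and zero on $\pi[\ell]^\flat\oplus\ker(e_\ell)$. *)

theory Defs
  imports "HOL-Analysis.Analysis" "HOL-Algebra.Group"
begin

text \<open>
  A non-archimedean local field: a field that is locally compact for the topology of a nontrivial
  ultrametric absolute value \<open>\<bar>x\<bar> = dist 0 x\<close>. The absolute value need not be normalised. With the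
  metric in the type class, the product topology on matrices is the one of the library.
\<close>

class nonarch_local_field = field + metric_space +
  assumes dist_add_right: "dist (x + z) (y + z) = dist x y"
    and dist_zero_mult: "dist 0 (x * y) = dist 0 x * dist 0 y"
    and dist_ultrametric: "dist x z \<le> max (dist x y) (dist y z)"
    and absolute_value_nontrivial: "\<exists>x. x \<noteq> 0 \<and> dist 0 x \<noteq> 1"
    and locally_compact_field: "\<exists>U C. open U \<and> x \<in> U \<and> U \<subseteq> C \<and> compact C"

definition integer_ring :: "'k::nonarch_local_field set" where
  "integer_ring = {x. dist 0 x \<le> 1}"

definition max_ideal :: "'k::nonarch_local_field set" where
  "max_ideal = {x. dist 0 x < 1}"

definition uniformizer :: "'k::nonarch_local_field \<Rightarrow> bool" where
  "uniformizer t \<longleftrightarrow> max_ideal = (\<lambda>x. t * x) ` integer_ring"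

text \<open>The fractional ideal \<open>\<pp>\<^sup>j = t\<^sup>j \<oo>\<close>, which does not depend on the uniformizer \<open>t\<close>.\<close>

definition max_ideal_power :: "int \<Rightarrow> 'k::nonarch_local_field set" where
  "max_ideal_power j = {t powi j * x | t x. uniformizer t \<and> x \<in> integer_ring}"

definition GL2 :: "('k::field ^ 2 ^ 2) monoid" where
  "GL2 = \<lparr>carrier = {A. invertible A}, mult = (**), one = mat 1\<rparr>"

definition SL2 :: "('k::field ^ 2 ^ 2) set" where
  "SL2 = {A. det A = 1}"

definition segment :: "int set \<Rightarrow> bool" where
  "segment l \<longleftrightarrow> (\<exists>m n. m \<le> n \<and> l = {m..n})"

definition proper_subsegments :: "int set \<Rightarrow> int set set" where
  "proper_subsegments l = {l'. segment l' \<and> l' \<subset> l}"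

definition seg_order :: "int set \<Rightarrow> ('k::nonarch_local_field ^ 2 ^ 2) set" where
  "seg_order l = {A. A $ 1 $ 1 \<in> integer_ring \<and> A $ 1 $ 2 \<in> max_ideal_power (- Min l) \<and>
                     A $ 2 $ 1 \<in> max_ideal_power (Max l) \<and> A $ 2 $ 2 \<in> integer_ring}"

definition seg_order_units :: "int set \<Rightarrow> ('k::nonarch_local_field ^ 2 ^ 2) set" where
  "seg_order_units l = {A \<in> seg_order l. \<exists>B \<in> seg_order l. A ** B = mat 1 \<and> B ** A = mat 1}"

definition seg_group ::
    "('k::nonarch_local_field ^ 2 ^ 2) set \<Rightarrow> int set \<Rightarrow> ('k ^ 2 ^ 2) set" where
  "seg_group G l = seg_order_units l \<inter> G"

text \<open>
  Left Haar measures on a matrix group with its Borel sigma-algebra. Regularity is not listed: it is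
  automatic for closed subgroups of \<open>GL\<^sub>2\<close>, which are locally compact and second countable.
\<close>

definition haar_measure ::
    "('k::nonarch_local_field ^ 2 ^ 2) set \<Rightarrow> ('k ^ 2 ^ 2) measure \<Rightarrow> bool" where
  "haar_measure G \<mu> \<longleftrightarrow>
     sets \<mu> = sets (restrict_space borel G) \<and>
     (\<forall>g\<in>G. \<forall>A\<in>sets \<mu>. emeasure \<mu> ((\<lambda>h. g ** h) ` A) = emeasure \<mu> A) \<and>
     (\<forall>C. C \<subseteq> G \<and> compact C \<longrightarrow> emeasure \<mu> C < \<infinity>) \<and>
     (\<forall>U. openin (top_of_set G) U \<and> U \<noteq> {} \<longrightarrow> 0 < emeasure \<mu> U)"

locale smooth_representation = vector_space smul
  for smul :: "complex \<Rightarrow> 'v::ab_group_add \<Rightarrow> 'v" +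
  fixes G :: "('k::nonarch_local_field ^ 2 ^ 2) set"
    and \<pi> :: "'k ^ 2 ^ 2 \<Rightarrow> 'v \<Rightarrow> 'v"
  assumes rep_linear: "g \<in> G \<Longrightarrow> Vector_Spaces.linear smul smul (\<pi> g)"
    and rep_one: "\<pi> (mat 1) v = v"
    and rep_mult: "g \<in> G \<Longrightarrow> h \<in> G \<Longrightarrow> \<pi> (g ** h) v = \<pi> g (\<pi> h v)"
    and rep_smooth: "openin (top_of_set G) {g \<in> G. \<pi> g v = v}"

text \<open>
  The integral of a function with values in a complex vector space without topology. It is meant for
  locally constant functions of compact support; such a function has finitely many nonzero values,
  each taken on a compact open set.
\<close>

definition lc_integral ::
    "(complex \<Rightarrow> 'v \<Rightarrow> 'v) \<Rightarrow> 'g measure \<Rightarrow> ('g \<Rightarrow> 'v) \<Rightarrow> 'v::ab_group_add" where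
  "lc_integral smul \<mu> F =
     (\<Sum>w \<in> F ` space \<mu> - {0}. smul (complex_of_real (measure \<mu> {g \<in> space \<mu>. F g = w})) w)"

definition rep_operator ::
    "(complex \<Rightarrow> 'v \<Rightarrow> 'v) \<Rightarrow> 'g measure \<Rightarrow> ('g \<Rightarrow> 'v \<Rightarrow> 'v) \<Rightarrow>
     ('g \<Rightarrow> complex) \<Rightarrow> 'v \<Rightarrow> 'v::ab_group_add" where
  "rep_operator smul \<mu> \<pi> f v = lc_integral smul \<mu> (\<lambda>g. smul (f g) (\<pi> g v))"

definition seg_average ::
    "(complex \<Rightarrow> 'v \<Rightarrow> 'v) \<Rightarrow> ('k::nonarch_local_field ^ 2 ^ 2) set \<Rightarrow> ('k ^ 2 ^ 2) measure \<Rightarrow>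
     ('k ^ 2 ^ 2 \<Rightarrow> 'v \<Rightarrow> 'v) \<Rightarrow> int set \<Rightarrow> 'v \<Rightarrow> 'v::ab_group_add" where
  "seg_average smul G \<mu> \<pi> l =
     rep_operator smul \<mu> \<pi>
       (\<lambda>g. inverse (complex_of_real (measure \<mu> (seg_group G l))) * indicator (seg_group G l) g)"

definition seg_fixed ::
    "('k::nonarch_local_field ^ 2 ^ 2) set \<Rightarrow> ('k ^ 2 ^ 2 \<Rightarrow> 'v \<Rightarrow> 'v) \<Rightarrow> int set \<Rightarrow> 'v set" where
  "seg_fixed G \<pi> l = {v. \<forall>g \<in> seg_group G l. \<pi> g v = v}"

definition seg_flat ::
    "('k::nonarch_local_field ^ 2 ^ 2) set \<Rightarrow> ('k ^ 2 ^ 2 \<Rightarrow> 'v \<Rightarrow> 'v) \<Rightarrow> int set \<Rightarrow>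
     'v::ab_group_add set" where
  "seg_flat G \<pi> l =
     {\<Sum>l' \<in> proper_subsegments l. x l' | x. \<forall>l' \<in> proper_subsegments l. x l' \<in> seg_fixed G \<pi> l'}"

definition seg_sharp ::
    "(complex \<Rightarrow> 'v \<Rightarrow> 'v) \<Rightarrow> ('k::nonarch_local_field ^ 2 ^ 2) set \<Rightarrow> ('k ^ 2 ^ 2) measure \<Rightarrow>
     ('k ^ 2 ^ 2 \<Rightarrow> 'v \<Rightarrow> 'v) \<Rightarrow> int set \<Rightarrow> 'v::ab_group_add set" where
  "seg_sharp smul G \<mu> \<pi> l =
     {v \<in> seg_fixed G \<pi> l. \<forall>l' \<in> proper_subsegments l. seg_average smul G \<mu> \<pi> l' v = 0}"

text \<open>
  \<open>E\<close> is the projector onto \<open>A\<close> afforded by a decomposition \<open>A \<oplus> B \<oplus> C\<close> of the whole space;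
  that the sum is direct and exhausts the space is part of the condition.
\<close>

definition projector_afforded_by ::
    "'v set \<Rightarrow> 'v set \<Rightarrow> 'v set \<Rightarrow> ('v::ab_group_add \<Rightarrow> 'v) \<Rightarrow> bool" where
  "projector_afforded_by A B C E \<longleftrightarrow>
     bij_betw (\<lambda>(a, b, c). a + b + c) (A \<times> B \<times> C) UNIV \<and>
     (\<forall>a\<in>A. \<forall>b\<in>B. \<forall>c\<in>C. E (a + b + c) = a)"

definition standard_projector ::
    "(complex \<Rightarrow> 'v \<Rightarrow> 'v) \<Rightarrow> ('k::nonarch_local_field ^ 2 ^ 2) set \<Rightarrow> ('k ^ 2 ^ 2) measure \<Rightarrow>
     ('k ^ 2 ^ 2 \<Rightarrow> 'v \<Rightarrow> 'v) \<Rightarrow> int set \<Rightarrow> ('v::ab_group_add \<Rightarrow> 'v) \<Rightarrow> bool" where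
  "standard_projector smul G \<mu> \<pi> l E \<longleftrightarrow>
     projector_afforded_by (seg_sharp smul G \<mu> \<pi> l) (seg_flat G \<pi> l)
       {v. seg_average smul G \<mu> \<pi> l v = 0} E"

end

theory Submission
  imports Defs
begin

text \<open>
  The group \<open>K\<close> of a segment is compact and open and stabilisers are open, so \<open>K\<close>-orbits are finite and
  averaging over \<open>K\<close> is averaging over a finite orbit. Put \<open>A = m+1..n\<close>, \<open>B = m..n-1\<close> and \<open>C = m+1..n-1\<close>.
  For \<open>n - m \<ge> 3\<close> an element of the group of \<open>C\<close> has unit diagonal, since the product of its off-diagonal
  entries lies in the maximal ideal; clearing the upper right entry by an upper unipotent matrix gives
  \<open>K\<^sub>C = K\<^sub>A K\<^sub>B\<close>, hence \<open>e\<^sub>A e\<^sub>B = e\<^sub>C = e\<^sub>B e\<^sub>A\<close>. Every proper subsegment lies in \<open>A\<close> or in \<open>B\<close>, so the claim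
  is the algebra of the commuting idempotents \<open>e\<^sub>A\<close>, \<open>e\<^sub>B\<close>: the operator is \<open>(1 - e\<^sub>A) (1 - e\<^sub>B)\<close> on the image
  of the idempotent of \<open>m..n\<close>.
\<close>

subsection \<open>Averages over finite orbits\<close>

text \<open>The group is given as a set of operators: group elements with the same action are
  identified, which leaves every orbit unchanged.\<close>

definition orbit :: "('v \<Rightarrow> 'v) set \<Rightarrow> 'v \<Rightarrow> 'v set" where
  "orbit H v = (\<lambda>h. h v) ` H"

lemma orbit_memI: "h \<in> H \<Longrightarrow> h v \<in> orbit H v"
  by (simp add: orbit_def)

lemma orbit_comp_memI: "h \<circ> g \<in> H \<Longrightarrow> h (g v) \<in> orbit H v"
  using orbit_memI by fastforce

text \<open>Averaging over the orbit instead of over \<open>H\<close> needs neither a measure on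
  \<open>H\<close> nor finiteness of \<open>H\<close>. Both averages agree because \<open>H\<close>
  acts transitively on the orbit.\<close>

definition orbit_average ::
    "(complex \<Rightarrow> 'v \<Rightarrow> 'v) \<Rightarrow> ('v \<Rightarrow> 'v) set \<Rightarrow> 'v \<Rightarrow> 'v::ab_group_add" where
  "orbit_average smul H v = smul (inverse (of_nat (card (orbit H v)))) (\<Sum>(orbit H v))"

locale finite_orbit_group = vector_space smul
  for smul :: "complex \<Rightarrow> 'v::ab_group_add \<Rightarrow> 'v" +
  fixes H :: "('v \<Rightarrow> 'v) set"
  assumes H_linear: "h \<in> H \<Longrightarrow> Vector_Spaces.linear smul smul h"
    and H_id: "id \<in> H"
    and H_comp: "h \<in> H \<Longrightarrow> h' \<in> H \<Longrightarrow> h \<circ> h' \<in> H"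
    and H_inverse: "h \<in> H \<Longrightarrow> \<exists>h'\<in>H. h' \<circ> h = id \<and> h \<circ> h' = id"
    and finite_orbit: "finite (orbit H v)"
begin

abbreviation avg :: "'v \<Rightarrow> 'v" where
  "avg \<equiv> orbit_average smul H"

lemma inj_H: "h \<in> H \<Longrightarrow> inj h"
  using H_inverse by (metis inj_on_id inj_on_imageI2)

lemma orbit_image:
  assumes "h \<in> H"
  shows "h ` orbit H v = orbit H v" "orbit H (h v) = orbit H v"
proof -
  obtain h' where h': "h' \<in> H" "h' \<circ> h = id" "h \<circ> h' = id"
    using H_inverse assms by blast
  have "h (g v) \<in> orbit H v" if "g \<in> H" for g
    using H_comp[OF assms that] by (rule orbit_comp_memI)
  moreover have "g v \<in> h ` orbit H v" if "g \<in> H" for g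
  proof -
    have "g v = h ((h' \<circ> g) v)"
      using h'(3) by (simp add: fun_eq_iff)
    then show ?thesis
      using H_comp[OF h'(1) that] unfolding orbit_def by blast
  qed
  ultimately show "h ` orbit H v = orbit H v"
    by (auto simp: orbit_def)
  have "g (h v) \<in> orbit H v" if "g \<in> H" for g
    using H_comp[OF that assms] by (rule orbit_comp_memI)
  moreover have "g v \<in> orbit H (h v)" if "g \<in> H" for g
  proof -
    have "g v = (g \<circ> h') (h v)"
      using h'(2) by (simp add: fun_eq_iff)
    then show ?thesis
      using H_comp[OF that h'(1)] unfolding orbit_def by blast
  qed
  ultimately show "orbit H (h v) = orbit H v"
    by (auto simp: orbit_def)
qed

text \<open>The fibres of an equivariant map between transitive sets are equinumerous.\<close>

lemma avg_equivariant:
  fixes act :: "('v \<Rightarrow> 'v) \<Rightarrow> 'x \<Rightarrow> 'x" and \<phi> :: "'x \<Rightarrow> 'v"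
  assumes X: "X = (\<lambda>h. act h x) ` H" "finite X" "x \<in> X"
    and act: "\<And>h. h \<in> H \<Longrightarrow> inj_on (act h) X" "\<And>h. h \<in> H \<Longrightarrow> act h ` X \<subseteq> X"
    and \<phi>: "\<And>h y. h \<in> H \<Longrightarrow> y \<in> X \<Longrightarrow> \<phi> (act h y) = h (\<phi> y)"
  shows "avg (\<phi> x) = smul (inverse (of_nat (card X))) (\<Sum>y\<in>X. \<phi> y)"
proof -
  define fib where "fib u = {y \<in> X. \<phi> y = u}" for u
  have orb: "\<phi> ` X = orbit H (\<phi> x)"
    unfolding orbit_def X(1) image_image using \<phi> X(3) by (intro image_cong) auto
  \<comment> \<open>An inequality suffices here: applied to an operator and to its inverse it yields
    equality of the fibre sizes.\<close>
  have fib_le: "card (fib u) \<le> card (fib (h u))" if h: "h \<in> H" for h u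
  proof (rule card_inj_on_le[where f = "act h"])
    show "inj_on (act h) (fib u)"
      using act(1)[OF h] by (rule inj_on_subset) (auto simp: fib_def)
    show "act h ` fib u \<subseteq> fib (h u)"
      using act(2)[OF h] \<phi>[OF h] by (auto simp: fib_def)
    show "finite (fib (h u))"
      using X(2) by (simp add: fib_def)
  qed
  have fib: "card (fib u) = card (fib (\<phi> x))" if u: "u \<in> orbit H (\<phi> x)" for u
  proof -
    obtain h where h: "h \<in> H" "u = h (\<phi> x)"
      using u by (auto simp: orbit_def)
    obtain h' where h': "h' \<in> H" "h' \<circ> h = id"
      using H_inverse h(1) by blast
    have "h' u = \<phi> x"
      using h(2) h'(2) by (metis comp_apply id_apply)
    then show ?thesis
      using fib_le[OF h(1), of "\<phi> x"] fib_le[OF h'(1), of u] h(2) by simp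
  qed
  let ?c = "card (fib (\<phi> x))"
  have "(\<Sum>y\<in>X. \<phi> y) = (\<Sum>u\<in>orbit H (\<phi> x). \<Sum>y\<in>fib u. \<phi> y)"
    unfolding fib_def orb[symmetric] by (rule sum.image_gen[OF X(2)])
  also have "\<dots> = (\<Sum>u\<in>orbit H (\<phi> x). smul (of_nat ?c) u)"
  proof (rule sum.cong[OF refl])
    fix u assume u: "u \<in> orbit H (\<phi> x)"
    have "(\<Sum>y\<in>fib u. \<phi> y) = (\<Sum>y\<in>fib u. u)"
      by (rule sum.cong) (auto simp: fib_def)
    also have "\<dots> = smul (of_nat (card (fib u))) u"
      by (rule sum_constant_scale)
    finally show "(\<Sum>y\<in>fib u. \<phi> y) = smul (of_nat ?c) u"
      using fib[OF u] by simp
  qed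
  also have "\<dots> = smul (of_nat ?c) (\<Sum>(orbit H (\<phi> x)))"
    by (simp add: scale_sum_right)
  finally have sum: "(\<Sum>y\<in>X. \<phi> y) = smul (of_nat ?c) (\<Sum>(orbit H (\<phi> x)))" .
  have "card X = (\<Sum>u\<in>orbit H (\<phi> x). card (fib u))"
    using sum.image_gen[OF X(2), of "\<lambda>_. 1::nat" \<phi>] by (simp add: fib_def orb)
  then have card: "card X = card (orbit H (\<phi> x)) * ?c"
    using fib by simp
  have "?c \<noteq> 0"
    using X(2,3) by (auto simp: fib_def)
  then show ?thesis
    unfolding orbit_average_def sum card by (simp add: field_simps)
qed

text \<open>The orbits of \<open>v\<close>, \<open>w\<close> and \<open>v + w\<close> may differ in
  size, so additivity is not visible term by term. All three are equivariant images of the orbit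
  \<open>X\<close> of the pair \<open>(v, w)\<close>, under the two projections and the sum, so all
  three averages can be taken over \<open>X\<close>.\<close>

lemma linear_avg: "Vector_Spaces.linear smul smul avg"
proof (unfold Vector_Spaces.linear_iff, intro conjI allI vector_space_axioms)
  fix v w :: 'v
  let ?act = "\<lambda>h. map_prod h (h :: 'v \<Rightarrow> 'v)"
  define X where "X = (\<lambda>h. ?act h (v, w)) ` H"
  have "X \<subseteq> orbit H v \<times> orbit H w"
    by (auto simp: X_def orbit_def)
  then have fin: "finite X"
    using finite_orbit by (meson finite_SigmaI finite_subset)
  have mem: "(v, w) \<in> X"
    using H_id unfolding X_def by (rule rev_image_eqI) simp
  have inj: "inj_on (?act h) X" if "h \<in> H" for h
    using inj_H[OF that] by (auto simp: inj_on_def)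
  have sub: "?act h ` X \<subseteq> X" if "h \<in> H" for h
    using H_comp[OF that] unfolding X_def image_image
    by (auto intro!: image_eqI[where x = "h \<circ> _"])
  note avg_X = avg_equivariant[OF X_def fin mem inj sub]
  have "avg v = smul (inverse (of_nat (card X))) (\<Sum>y\<in>X. fst y)"
    using avg_X[of fst] by simp
  moreover have "avg w = smul (inverse (of_nat (card X))) (\<Sum>y\<in>X. snd y)"
    using avg_X[of snd] by simp
  moreover have "avg (v + w) = smul (inverse (of_nat (card X))) (\<Sum>y\<in>X. fst y + snd y)"
    using avg_X[of "\<lambda>y. fst y + snd y"] H_linear
    by (simp add: Vector_Spaces.linear_iff)
  ultimately show "avg (v + w) = avg v + avg w"
    by (simp add: sum.distrib scale_right_distrib)
next
  fix c v
  \<comment> \<open>Now the orbit of \<open>v\<close> is the common index set and scaling by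
    \<open>c\<close> is the equivariant map. This includes \<open>c = 0\<close>, where the orbit of
    the image shrinks to a point.\<close>
  have "avg (smul c v) = smul (inverse (of_nat (card (orbit H v)))) (\<Sum>y\<in>orbit H v. smul c y)"
  proof (rule avg_equivariant[where act = id])
    show "inj_on (id h) (orbit H v)" if "h \<in> H" for h
      using inj_H[OF that] by (auto simp: inj_on_def)
  qed (use finite_orbit H_id orbit_image H_linear in
      \<open>auto simp: orbit_def Vector_Spaces.linear_iff image_iff intro: bexI[of _ id]\<close>)
  then show "avg (smul c v) = smul c (avg v)"
    by (simp add: orbit_average_def scale_sum_right mult.commute)
qed

lemma avg_apply: "h \<in> H \<Longrightarrow> avg (h v) = avg v"
  by (simp add: orbit_average_def orbit_image)

lemma avg_invariant:
  assumes "h \<in> H"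
  shows "h (avg v) = avg v"
proof -
  interpret h: Vector_Spaces.linear smul smul h
    using H_linear[OF assms] .
  have "(\<Sum>u\<in>orbit H v. h u) = \<Sum>(h ` orbit H v)"
    using inj_H[OF assms] by (simp add: sum.reindex inj_on_subset)
  then show ?thesis
    by (simp add: orbit_average_def h.scale h.sum orbit_image[OF assms])
qed

lemma avg_of_fixed:
  assumes "\<And>h. h \<in> H \<Longrightarrow> h v = v"
  shows "avg v = v"
proof -
  have "orbit H v = {v}"
    using assms orbit_memI[OF H_id, of v] by (auto simp: orbit_def)
  then show ?thesis
    by (simp add: orbit_average_def)
qed

lemma avg_eq_self_iff: "avg v = v \<longleftrightarrow> (\<forall>h\<in>H. h v = v)"
  using avg_invariant avg_of_fixed by metis

text \<open>An average over \<open>H\<close> is fixed by all of \<open>H'\<close>. Conversely,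
  \<open>avg\<close> is constant on \<open>H\<close>-orbits, hence on the smaller
  \<open>H'\<close>-orbits, so a preliminary average over \<open>H'\<close> does not change
  it.\<close>

lemma avg_subgroup_avg:
  assumes "finite_orbit_group smul H'" and "H' \<subseteq> H"
  shows "orbit_average smul H' (avg v) = avg v" and "avg (orbit_average smul H' v) = avg v"
proof -
  interpret H': finite_orbit_group smul H'
    using assms(1) .
  interpret avg: Vector_Spaces.linear smul smul avg
    using linear_avg .
  show "orbit_average smul H' (avg v) = avg v"
    using assms(2) avg_invariant by (intro H'.avg_of_fixed) auto
  have "avg u = avg v" if "u \<in> orbit H' v" for u
    using that assms(2) avg_apply by (auto simp: orbit_def)
  then have "avg (\<Sum>(orbit H' v)) = smul (of_nat (card (orbit H' v))) (avg v)"
    by (simp add: avg.sum sum_constant_scale)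
  moreover have "card (orbit H' v) \<noteq> 0"
    using H'.H_id H'.finite_orbit by (auto simp: orbit_def)
  ultimately show "avg (orbit_average smul H' v) = avg v"
    by (simp add: orbit_average_def[of smul H'] avg.scale)
qed

text \<open>On a vector fixed by \<open>B\<close>, the orbits under \<open>A\<close> and under \<open>H = A B\<close> agree.\<close>

lemma avg_avg_factorization:
  assumes A: "finite_orbit_group smul A" "A \<subseteq> H" and B: "finite_orbit_group smul B" "B \<subseteq> H"
    and factor: "\<And>h. h \<in> H \<Longrightarrow> \<exists>a\<in>A. \<exists>b\<in>B. h = a \<circ> b"
  shows "orbit_average smul A (orbit_average smul B v) = avg v"
proof -
  interpret B: finite_orbit_group smul B
    using B(1) .
  have "h (B.avg v) \<in> orbit A (B.avg v)" if "h \<in> H" for h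
    using factor[OF that] by (auto simp: B.avg_invariant intro: orbit_memI)
  then have "orbit A (B.avg v) = orbit H (B.avg v)"
    using A(2) by (auto simp: orbit_def)
  then have "orbit_average smul A (B.avg v) = avg (B.avg v)"
    by (simp add: orbit_average_def)
  also have "\<dots> = avg v"
    using avg_subgroup_avg(2)[OF B] .
  finally show ?thesis .
qed

end

section \<open>Projectors from commuting idempotents\<close>

text \<open>\<open>A\<close> and \<open>B\<close> are commuting idempotents below \<open>P\<close>,
  with product \<open>C\<close>. The operator acts as \<open>(1 - A) (1 - B)\<close> on the image of
  \<open>P\<close>; it kills the kernel of \<open>P\<close> because \<open>A\<close>,
  \<open>B\<close> and \<open>C\<close> all factor through \<open>P\<close>.\<close>

lemma projector_of_commuting_idempotents:
  fixes P A B C :: "'v::ab_group_add \<Rightarrow> 'v"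
  assumes lin: "Modules.additive P" "Modules.additive A" "Modules.additive B" "Modules.additive C"
    and P: "\<And>v. P (P v) = P v"
    and A: "\<And>v. A (A v) = A v" "\<And>v. P (A v) = A v" "\<And>v. A (P v) = A v"
    and B: "\<And>v. B (B v) = B v" "\<And>v. P (B v) = B v" "\<And>v. B (P v) = B v"
    and AB: "\<And>v. A (B v) = C v" "\<And>v. B (A v) = C v"
  shows "projector_afforded_by {v. P v = v \<and> A v = 0 \<and> B v = 0}
    {x + y | x y. A x = x \<and> B y = y} {v. P v = 0} (\<lambda>v. P v - A v - B v + C v)"
    (is "projector_afforded_by ?sharp ?flat ?ker ?E")
proof -
  note add = lin[THEN Modules.additive.add] and diff = lin[THEN Modules.additive.diff]
    and zero = lin[THEN Modules.additive.zero]
  have AC: "A (C v) = C v" and BC: "B (C v) = C v" and PC: "P (C v) = C v" for v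
    using A B AB by metis+
  have CP: "C (P v) = C v" for v
    using B AB by metis
  have E_sharp: "?E v = v" if "v \<in> ?sharp" for v
    using that AB(1)[of v] zero by simp
  have E_flat: "?E v = 0" and P_flat: "P v = v" if v: "v \<in> ?flat" for v
  proof -
    obtain x y where xy: "v = x + y" "A x = x" "B y = y"
      using v by blast
    \<comment> \<open>For \<open>x = A x\<close> the terms \<open>P x\<close> and \<open>A x\<close>
      cancel, and so do \<open>B x\<close> and \<open>C x = B (A x)\<close>. The case of
      \<open>y\<close> is symmetric.\<close>
    have x: "P x = x" "C x = B x"
      using xy A(2)[of x] AB(2)[of x] by auto
    have y: "P y = y" "C y = A y"
      using xy B(2)[of y] AB(1)[of y] by auto
    show "?E v = 0" "P v = v"
      by (simp_all add: xy add x y)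
  qed
  have E_ker: "?E v = 0" if "v \<in> ?ker" for v
  proof -
    have "P v = 0" "A v = 0" "B v = 0" "C v = 0"
      using that A(3)[of v] B(3)[of v] CP[of v] zero by auto
    then show ?thesis by simp
  qed
  have E: "?E (a + b + c) = a" if "a \<in> ?sharp" "b \<in> ?flat" "c \<in> ?ker" for a b c
  proof -
    have "?E (a + b + c) = ?E a + ?E b + ?E c"
      by (simp add: add)
    then show ?thesis
      using E_sharp[OF that(1)] E_flat[OF that(2)] E_ker[OF that(3)] by simp
  qed
  have "inj_on (\<lambda>(a, b, c). a + b + c) (?sharp \<times> ?flat \<times> ?ker)"
  proof (intro inj_onI, clarify)
    fix a x y c a' x' y' c'
    assume *: "P a = a" "A a = 0" "B a = 0" "P a' = a'" "A a' = 0" "B a' = 0"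
      "A x = x" "B y = y" "A x' = x'" "B y' = y'" "P c = 0" "P c' = 0"
      "a + (x + y) + c = a' + (x' + y') + c'"
    have flat: "x + y \<in> ?flat" "x' + y' \<in> ?flat"
      using * by blast+
    \<comment> \<open>The operator recovers the first component, \<open>P\<close> then removes the
      third, and the remaining one follows by cancellation.\<close>
    have "a = a'"
      using E[OF _ flat(1), of a c] E[OF _ flat(2), of a' c'] * by simp
    moreover have "P (u + v + w) = u + v" if "P u = u" "P v = v" "P w = 0" for u v w
      by (simp add: add that)
    then have "a + (x + y) = a' + (x' + y')"
      using P_flat[OF flat(1)] P_flat[OF flat(2)] * by metis
    ultimately show "a = a' \<and> (x + y, c) = (x' + y', c')"
      using * by auto
  qed
  moreover have "v \<in> (\<lambda>(a, b, c). a + b + c) ` (?sharp \<times> ?flat \<times> ?ker)" for v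
  proof (rule image_eqI)
    \<comment> \<open>In the middle component \<open>A v\<close> is fixed by \<open>A\<close>, and
      \<open>B v - C v\<close> is fixed by \<open>B\<close> because \<open>B (C v) = C v\<close>.
      Subtracting \<open>C v\<close> avoids counting the common part of \<open>A v\<close> and
      \<open>B v\<close> twice.\<close>
    show "v = (\<lambda>(a, b, c). a + b + c) (?E v, A v + (B v - C v), v - P v)"
      by simp
    have "A v + (B v - C v) \<in> ?flat"
      using A(1)[of v] B(1)[of v] BC[of v] diff(3)[of "B v" "C v"] by fastforce
    then show "(?E v, A v + (B v - C v), v - P v) \<in> ?sharp \<times> ?flat \<times> ?ker"
      by (simp add: add diff P A B AB AC BC PC)
  qed
  ultimately show ?thesis
    unfolding projector_afforded_by_def bij_betw_def using E by blast
qed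

subsection \<open>Local fields\<close>

lemma dist_eq_dist_zero: "dist x y = dist 0 (x - y :: 'k::nonarch_local_field)"
  using dist_add_right[of y "-y" x] by (simp add: dist_commute)

lemma dist_zero_one [simp]: "dist 0 (1 :: 'k::nonarch_local_field) = 1"
  using dist_zero_mult[of 1 "1::'k"] by simp

lemma dist_zero_minus [simp]: "dist 0 (- x) = dist 0 (x :: 'k::nonarch_local_field)"
  using dist_eq_dist_zero[of 0 x] by simp

lemma dist_zero_add_le: "dist 0 (x + y) \<le> max (dist 0 x) (dist 0 (y :: 'k::nonarch_local_field))"
  using dist_ultrametric[of 0 "x + y" x] dist_add_right[of 0 x y] by (simp add: add.commute)

lemma dist_zero_diff_le: "dist 0 (x - y) \<le> max (dist 0 x) (dist 0 (y :: 'k::nonarch_local_field))"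
  using dist_zero_add_le[of x "- y"] by simp

lemma dist_zero_inverse: "dist 0 (inverse x) = inverse (dist 0 (x :: 'k::nonarch_local_field))"
proof (cases "x = 0")
  case False
  then have "dist 0 x * dist 0 (inverse x) = 1"
    using dist_zero_mult[of x "inverse x"] by simp
  then show ?thesis
    by (metis inverse_unique)
qed simp

lemma dist_zero_divide: "dist 0 (x / y) = dist 0 x / dist 0 (y :: 'k::nonarch_local_field)"
  by (simp add: divide_inverse dist_zero_mult dist_zero_inverse)

lemma dist_zero_power: "dist 0 (x ^ n) = dist 0 (x :: 'k::nonarch_local_field) ^ n"
  by (induction n) (simp_all add: dist_zero_mult)

lemma dist_zero_power_int: "dist 0 (x powi j) = dist 0 (x :: 'k::nonarch_local_field) powi j"
  by (simp add: power_int_def dist_zero_power dist_zero_inverse)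

section \<open>Continuity of the field operations\<close>

text \<open>This instance and the next one make sums and products of continuous functions
  continuous, and with them matrix products and determinants.\<close>

instance nonarch_local_field \<subseteq> topological_comm_monoid_add
proof
  fix a b :: 'a
  have "((\<lambda>x. dist (fst x + snd x) (a + b)) \<longlongrightarrow> 0) (nhds a \<times>\<^sub>F nhds b)"
  proof (rule tendsto_sandwich[OF _ _ tendsto_const])
    have "dist (x + y) (a + b) \<le> dist x a + dist y b" for x y :: 'a
      using dist_triangle[of "x + y" "a + b" "a + y"] dist_add_right[of x y a]
        dist_add_right[of y a b] by (simp add: add.commute)
    then show "\<forall>\<^sub>F x in nhds a \<times>\<^sub>F nhds b. dist (fst x + snd x) (a + b) \<le> dist (fst x) a + dist (snd x) b"
      by (intro always_eventually allI)
    have "((\<lambda>x. dist (fst x) a + dist (snd x) b) \<longlongrightarrow> dist a a + dist b b) (nhds a \<times>\<^sub>F nhds b)"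
      by (intro tendsto_intros filterlim_fst filterlim_snd)
    then show "((\<lambda>x. dist (fst x) a + dist (snd x) b) \<longlongrightarrow> 0) (nhds a \<times>\<^sub>F nhds b)"
      by simp
  qed auto
  then show "((\<lambda>x. fst x + snd x) \<longlongrightarrow> a + b) (nhds a \<times>\<^sub>F nhds b)"
    by (rule tendstoI[OF order_tendstoD(2)])
qed

instance nonarch_local_field \<subseteq> topological_semigroup_mult
proof
  fix a b :: 'a
  have "((\<lambda>x. dist (fst x * snd x) (a * b)) \<longlongrightarrow> 0) (nhds a \<times>\<^sub>F nhds b)"
  proof (rule tendsto_sandwich[OF _ _ tendsto_const])
    have "dist (x * y) (a * b) \<le> dist x a * dist 0 y + dist 0 a * dist y b" for x y :: 'a
      using dist_triangle[of "x * y" "a * b" "a * y"]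
      by (simp add: dist_eq_dist_zero[of "_ * _"] dist_eq_dist_zero[of x a] dist_eq_dist_zero[of y b]
          flip: left_diff_distrib right_diff_distrib dist_zero_mult)
    then show "\<forall>\<^sub>F x in nhds a \<times>\<^sub>F nhds b. dist (fst x * snd x) (a * b)
        \<le> dist (fst x) a * dist 0 (snd x) + dist 0 a * dist (snd x) b"
      by (intro always_eventually allI)
    have "((\<lambda>x. dist (fst x) a * dist 0 (snd x) + dist 0 a * dist (snd x) b)
        \<longlongrightarrow> dist a a * dist 0 b + dist 0 a * dist b b) (nhds a \<times>\<^sub>F nhds b)"
      by (intro tendsto_intros filterlim_fst filterlim_snd)
    then show "((\<lambda>x. dist (fst x) a * dist 0 (snd x) + dist 0 a * dist (snd x) b) \<longlongrightarrow> 0)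
        (nhds a \<times>\<^sub>F nhds b)"
      by simp
  qed auto
  then show "((\<lambda>x. fst x * snd x) \<longlongrightarrow> a * b) (nhds a \<times>\<^sub>F nhds b)"
    by (rule tendstoI[OF order_tendstoD(2)])
qed

text \<open>By the strong triangle inequality, a ball of radius \<open>r\<close> around any point of
  the closed ball stays inside it.\<close>

lemma open_dist_le:
  fixes a :: "'k::nonarch_local_field"
  assumes "r > 0"
  shows "open {x. dist a x \<le> r}"
  unfolding open_dist
proof (intro ballI exI conjI allI impI)
  fix x y assume "x \<in> {x. dist a x \<le> r}" "dist y x < r"
  then show "y \<in> {x. dist a x \<le> r}"
    using dist_ultrametric[of a y x] by (auto simp: dist_commute)
qed (use assms in auto)

text \<open>A point at distance at least \<open>r\<close> from \<open>a\<close> keeps such a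
  distance when it moves by less than \<open>r\<close>, so the complement is open.\<close>

lemma closed_dist_less:
  fixes a :: "'k::nonarch_local_field"
  assumes "r > 0"
  shows "closed {x. dist a x < r}"
  unfolding closed_def open_dist
proof (intro ballI exI conjI allI impI)
  fix x y assume "x \<in> - {x. dist a x < r}" "dist y x < r"
  then show "y \<in> - {x. dist a x < r}"
    using dist_ultrametric[of a x y] by (auto simp: dist_commute)
qed (use assms in auto)

text \<open>Nontriviality gives an element of absolute value below 1, after inversion if necessary;
  its powers tend to 0.\<close>

lemma exists_small_dist_zero:
  assumes "r > 0"
  shows "\<exists>x :: 'k::nonarch_local_field. x \<noteq> 0 \<and> dist 0 x < 1 \<and> dist 0 x \<le> r"
proof -
  obtain y :: 'k where y: "y \<noteq> 0" "dist 0 y \<noteq> 1"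
    using absolute_value_nontrivial by blast
  define z where "z = (if dist 0 y < 1 then y else inverse y)"
  have z: "z \<noteq> 0" "dist 0 z < 1"
    using y by (auto simp: z_def dist_zero_inverse inverse_less_1_iff)
  obtain n where "dist 0 z ^ n < r"
    using real_arch_pow_inv[OF assms z(2)] by blast
  \<comment> \<open>The exponent is \<open>Suc n\<close> because \<open>n\<close> may be 0 when
    \<open>r > 1\<close>, and \<open>z ^ 0\<close> has absolute value 1.\<close>
  moreover have "dist 0 z ^ Suc n \<le> dist 0 z ^ n"
    using z(2) by (intro power_decreasing) auto
  moreover have "dist 0 z ^ Suc n < 1"
    using z(2) by (rule power_Suc_less_one[rotated]) (use z(1) in auto)
  ultimately show ?thesis
    using z(1) by (intro exI[of _ "z ^ Suc n"] conjI)
      (auto simp only: dist_zero_power power_eq_0_iff)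
qed

text \<open>Local compactness makes one ball around 0 compact, and multiplication by a nonzero
  scalar enlarges it beyond any given radius.\<close>

lemma compact_dist_zero_le: "compact {x :: 'k::nonarch_local_field. dist 0 x \<le> r}"
proof -
  obtain U C :: "'k set" where UC: "open U" "0 \<in> U" "U \<subseteq> C" "compact C"
    using locally_compact_field by blast
  obtain e where e: "e > 0" "\<And>x. dist x 0 < e \<Longrightarrow> x \<in> U"
    using UC(1,2) unfolding open_dist by blast
  \<comment> \<open>The maximum keeps \<open>e / (2 * s)\<close> positive for every
    \<open>r\<close>. An element \<open>t\<close> of at most this size carries the ball of radius
    \<open>r\<close> into the ball of radius \<open>e / 2\<close>.\<close>
  define s where "s = max r 1"
  have s: "s > 0" "r \<le> s"
    by (auto simp: s_def)
  obtain t :: 'k where t: "t \<noteq> 0" "dist 0 t \<le> e / (2 * s)"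
    using exists_small_dist_zero[of "e / (2 * s)"] e(1) s(1) by fastforce
  have "{x :: 'k. dist 0 x \<le> e / 2} \<subseteq> C"
    using UC(3) e by (fastforce simp: dist_commute)
  moreover have "closed {x :: 'k. dist 0 x \<le> e / 2}"
    using closed_cball[of 0 "e / 2"] by (simp add: cball_def)
  ultimately have "compact {x :: 'k. dist 0 x \<le> e / 2}"
    using UC(4) compact_Int_closed[of C] by (metis inf.absorb_iff2)
  then have "compact ((*) (inverse t) ` {x. dist 0 x \<le> e / 2})"
    by (intro compact_continuous_image continuous_intros)
  moreover have "{x :: 'k. dist 0 x \<le> r} \<subseteq> (*) (inverse t) ` {x. dist 0 x \<le> e / 2}"
  proof
    fix x :: 'k assume x: "x \<in> {x. dist 0 x \<le> r}"
    have "dist 0 (t * x) \<le> e / (2 * s) * s"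
      unfolding dist_zero_mult using t(2) x s e(1) by (intro mult_mono) auto
    then show "x \<in> (*) (inverse t) ` {x. dist 0 x \<le> e / 2}"
      using t(1) s(1) by (intro image_eqI[where x = "t * x"]) auto
  qed
  moreover have "closed {x :: 'k. dist 0 x \<le> r}"
    using closed_cball[of 0 r] by (simp add: cball_def)
  ultimately show ?thesis
    using compact_Int_closed by (metis inf.absorb_iff2)
qed

section \<open>Uniformizers and fractional ideals\<close>

text \<open>Divisibility by \<open>t\<close> is a comparison of absolute values, so a generator of
  the maximal ideal is a nonzero element whose absolute value is the largest one below 1.\<close>

lemma uniformizer_iff:
  fixes t :: "'k::nonarch_local_field"
  shows "uniformizer t \<longleftrightarrow> t \<noteq> 0 \<and> (\<forall>x :: 'k. dist 0 x < 1 \<longleftrightarrow> dist 0 x \<le> dist 0 t)"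
proof
  assume t: "uniformizer t"
  obtain y :: 'k where y: "y \<noteq> 0" "dist 0 y < 1"
    using exists_small_dist_zero[of 1] by fastforce
  have mem: "dist 0 x < 1 \<longleftrightarrow> (\<exists>z. x = t * z \<and> dist 0 z \<le> 1)" for x :: 'k
    using t unfolding uniformizer_def max_ideal_def integer_ring_def
    by (metis (no_types, lifting) image_iff mem_Collect_eq)
  have "t \<noteq> 0"
    using mem[of y] y by auto
  moreover have "dist 0 x < 1" if "dist 0 x \<le> dist 0 t" for x :: 'k
  proof -
    have "x = t * (x / t)" "dist 0 (x / t) \<le> 1"
      using that \<open>t \<noteq> 0\<close> by (auto simp: dist_zero_divide)
    then show ?thesis
      using mem by blast
  qed
  moreover have "dist 0 x \<le> dist 0 t" if x: "dist 0 x < 1" for x :: 'k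
  proof -
    obtain z where "x = t * z" "dist 0 z \<le> 1"
      using mem x by blast
    then show ?thesis
      by (simp add: dist_zero_mult mult_left_le)
  qed
  ultimately show "t \<noteq> 0 \<and> (\<forall>x :: 'k. dist 0 x < 1 \<longleftrightarrow> dist 0 x \<le> dist 0 t)"
    by blast
next
  assume t: "t \<noteq> 0 \<and> (\<forall>x :: 'k. dist 0 x < 1 \<longleftrightarrow> dist 0 x \<le> dist 0 t)"
  show "uniformizer t"
    unfolding uniformizer_def max_ideal_def integer_ring_def
  proof (intro equalityI subsetI)
    fix x :: 'k assume "x \<in> {x. dist 0 x < 1}"
    then show "x \<in> (*) t ` {x. dist 0 x \<le> 1}"
      using t by (intro image_eqI[where x = "x / t"]) (auto simp: dist_zero_divide)
  next
    fix x assume "x \<in> (*) t ` {x. dist 0 x \<le> 1}"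
    then have "dist 0 x \<le> dist 0 t"
      by (auto simp: dist_zero_mult mult_left_le)
    then show "x \<in> {x. dist 0 x < 1}"
      using t by blast
  qed
qed

lemma uniformizer_bounds:
  fixes t :: "'k::nonarch_local_field"
  assumes "uniformizer t"
  shows "0 < dist 0 t" "dist 0 t < 1"
proof -
  have "t \<noteq> 0" "dist 0 t < 1"
    using iffD1[OF uniformizer_iff assms] by simp_all
  then show "0 < dist 0 t" "dist 0 t < 1"
    by simp_all
qed

lemma le_uniformizer:
  fixes t x :: "'k::nonarch_local_field"
  assumes "uniformizer t" "dist 0 x < 1"
  shows "dist 0 x \<le> dist 0 t"
  using iffD1[OF uniformizer_iff assms(1)] assms(2) by simp

text \<open>The maximal ideal is a closed subset of the compact unit ball, so the absolute value
  attains its maximum on it. This is the discreteness of the valuation.\<close>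

lemma uniformizer_exists: "\<exists>t :: 'k::nonarch_local_field. uniformizer t"
proof -
  define M where "M = {x :: 'k. dist 0 x \<le> 1} \<inter> {x. dist 0 x < 1}"
  have "compact M"
    unfolding M_def by (rule compact_Int_closed[OF compact_dist_zero_le closed_dist_less]) simp
  moreover have "0 \<in> M"
    by (simp add: M_def)
  moreover have "continuous_on M (dist 0)"
    by (intro continuous_intros)
  ultimately obtain t where "t \<in> M" "\<forall>x\<in>M. dist 0 x \<le> dist 0 t"
    using continuous_attains_sup[of M "dist 0"] by blast
  then obtain t :: 'k where t: "dist 0 t < 1" "\<And>x :: 'k. dist 0 x < 1 \<Longrightarrow> dist 0 x \<le> dist 0 t"
    by (auto simp: M_def)
  obtain y :: 'k where "y \<noteq> 0" "dist 0 y < 1"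
    using exists_small_dist_zero[of 1] by fastforce
  then have "t \<noteq> 0"
    using t(2)[of y] by auto
  moreover have "dist 0 x < 1 \<longleftrightarrow> dist 0 x \<le> dist 0 t" for x :: 'k
    using t(2)[of x] t(1) by linarith
  ultimately show ?thesis
    using uniformizer_iff by blast
qed

text \<open>All uniformizers have the same absolute value, so the union over them in the definition
  is a single ball.\<close>

lemma max_ideal_power_eq:
  fixes t :: "'k::nonarch_local_field"
  assumes "uniformizer t"
  shows "max_ideal_power j = {x :: 'k. dist 0 x \<le> dist 0 t powi j}"
proof (intro equalityI subsetI)
  fix x :: 'k assume "x \<in> max_ideal_power j"
  then obtain t' z where *: "uniformizer t'" "x = t' powi j * z" "dist 0 z \<le> 1"
    by (auto simp: max_ideal_power_def integer_ring_def)
  have "dist 0 t' = dist 0 t"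
    using *(1) assms by (intro order_antisym le_uniformizer uniformizer_bounds)
  then show "x \<in> {x. dist 0 x \<le> dist 0 t powi j}"
    using * by (simp add: dist_zero_mult dist_zero_power_int mult_left_le)
next
  fix x :: 'k assume x: "x \<in> {x. dist 0 x \<le> dist 0 t powi j}"
  have t: "t \<noteq> 0"
    using uniformizer_bounds[OF assms] by auto
  then have "x = t powi j * (x / t powi j)" "x / t powi j \<in> integer_ring"
    using x by (auto simp: integer_ring_def dist_zero_divide dist_zero_power_int zero_less_power_int)
  then show "x \<in> max_ideal_power j"
    using assms unfolding max_ideal_power_def by blast
qed

subsection \<open>Orders of segments\<close>

lemma matrix_2_eq_iff:
  "(A :: 'a ^ 2 ^ 2) = B \<longleftrightarrow> A $ 1 $ 1 = B $ 1 $ 1 \<and> A $ 1 $ 2 = B $ 1 $ 2 \<and> A $ 2 $ 1 = B $ 2 $ 1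
    \<and> A $ 2 $ 2 = B $ 2 $ 2"
  by (auto simp: vec_eq_iff forall_2)

lemma matrix_matrix_mult_2:
  "((A :: 'a::semiring_1 ^ 2 ^ 2) ** B) $ i $ j = A $ i $ 1 * B $ 1 $ j + A $ i $ 2 * B $ 2 $ j"
  by (simp add: matrix_matrix_mult_def sum_2)

lemma mat_one_2 [simp]:
  "(mat 1 :: 'a::semiring_1 ^ 2 ^ 2) $ 1 $ 1 = 1" "(mat 1 :: 'a ^ 2 ^ 2) $ 1 $ 2 = 0"
  "(mat 1 :: 'a ^ 2 ^ 2) $ 2 $ 1 = 0" "(mat 1 :: 'a ^ 2 ^ 2) $ 2 $ 2 = 1"
  by (simp_all add: mat_def)

definition matrix_2 :: "'a \<Rightarrow> 'a \<Rightarrow> 'a \<Rightarrow> 'a \<Rightarrow> 'a ^ 2 ^ 2" where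
  "matrix_2 a b c d = (\<chi> i j. if i = 1 then if j = 1 then a else b else if j = 1 then c else d)"

lemma matrix_2_nth [simp]:
  "matrix_2 a b c d $ 1 $ 1 = a" "matrix_2 a b c d $ 1 $ 2 = b"
  "matrix_2 a b c d $ 2 $ 1 = c" "matrix_2 a b c d $ 2 $ 2 = d"
  by (simp_all add: matrix_2_def)

text \<open>\<open>B\<close> is the adjugate divided by the determinant; its explicit entries can be
  bounded by those of \<open>A\<close>.\<close>

lemma matrix_2_inverse:
  fixes A :: "'a::field ^ 2 ^ 2"
  assumes "det A \<noteq> 0"
  defines "B \<equiv> matrix_2 (A $ 2 $ 2 / det A) (- A $ 1 $ 2 / det A) (- A $ 2 $ 1 / det A) (A $ 1 $ 1 / det A)"
  shows "A ** B = mat 1" "B ** A = mat 1"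
  using assms(1) unfolding B_def matrix_2_eq_iff matrix_matrix_mult_2
  by (simp_all add: divide_simps) (simp_all add: det_2 algebra_simps)

lemma group_GL2: "Group.group (GL2 :: ('k::field ^ 2 ^ 2) monoid)"
proof (rule groupI)
  fix A :: "'k ^ 2 ^ 2" assume "A \<in> carrier GL2"
  then show "\<exists>B\<in>carrier GL2. B \<otimes>\<^bsub>GL2\<^esub> A = \<one>\<^bsub>GL2\<^esub>"
    by (auto simp: GL2_def invertible_def)
qed (auto simp: GL2_def invertible_mult matrix_mul_assoc invertible_def[of "mat 1"]
    intro: exI[of _ "mat 1"])

lemma continuous_on_matrix_mult [continuous_intros]:
  fixes f g :: "'a::topological_space \<Rightarrow> 'k::nonarch_local_field ^ 2 ^ 2"
  assumes "continuous_on S f" "continuous_on S g"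
  shows "continuous_on S (\<lambda>x. f x ** g x)"
  unfolding matrix_matrix_mult_def sum_2 using assms by (intro continuous_intros)

lemma dist_zero_det_le:
  fixes A :: "'k::nonarch_local_field ^ 2 ^ 2"
  shows "dist 0 (det A) \<le> max (dist 0 (A $ 1 $ 1) * dist 0 (A $ 2 $ 2)) (dist 0 (A $ 1 $ 2) * dist 0 (A $ 2 $ 1))"
  unfolding det_2 using dist_zero_diff_le by (metis dist_zero_mult)

lemma continuous_on_det_2 [continuous_intros]:
  fixes f :: "'a::topological_space \<Rightarrow> 'k::nonarch_local_field ^ 2 ^ 2"
  assumes "continuous_on S f"
  shows "continuous_on S (\<lambda>x. det (f x))"
proof -
  \<comment> \<open>The subtraction is written as adding a multiple by -1, so that continuity of
    sums and products suffices.\<close>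
  have "continuous_on S (\<lambda>x. f x $ 1 $ 1 * f x $ 2 $ 2 + (- 1) * (f x $ 1 $ 2 * f x $ 2 $ 1))"
    using assms by (intro continuous_intros)
  then show ?thesis
    by (simp add: det_2)
qed

section \<open>Orders and their units in terms of absolute values\<close>

lemma seg_order_eq:
  fixes t :: "'k::nonarch_local_field"
  assumes "uniformizer t" "m \<le> n"
  shows "seg_order {m..n} = {A :: 'k ^ 2 ^ 2. dist 0 (A $ 1 $ 1) \<le> 1 \<and> dist 0 (A $ 1 $ 2) \<le> dist 0 t powi (- m)
    \<and> dist 0 (A $ 2 $ 1) \<le> dist 0 t powi n \<and> dist 0 (A $ 2 $ 2) \<le> 1}"
proof -
  have "Min {m..n} = m" "Max {m..n} = n"
    using assms(2) by (auto intro!: Min_eqI Max_eqI)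
  then show ?thesis
    by (simp add: seg_order_def max_ideal_power_eq[OF assms(1)] integer_ring_def)
qed

text \<open>In the product of the off-diagonal entries only the length of the segment survives. This
  controls the diagonal of a matrix product as well as the determinant.\<close>

lemma off_diagonal_le:
  fixes t b c :: "'k::nonarch_local_field"
  assumes "uniformizer t" "dist 0 b \<le> dist 0 t powi (- m)" "dist 0 c \<le> dist 0 t powi n"
  shows "dist 0 b * dist 0 c \<le> dist 0 t powi (n - m)"
proof -
  have "dist 0 b * dist 0 c \<le> dist 0 t powi (- m) * dist 0 t powi n"
    using assms by (intro mult_mono) auto
  also have "\<dots> = dist 0 t powi (n - m)"
    using uniformizer_bounds[OF assms(1)] by (simp add: power_int_add[symmetric])
  finally show ?thesis .
qed

lemma powi_le_one:
  fixes q :: real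
  assumes "0 < q" "q < 1" "0 \<le> j"
  shows "q powi j \<le> 1"
  using assms by (simp add: power_int_def power_le_one)

lemma powi_less_one:
  fixes q :: real
  assumes "0 < q" "q < 1" "0 < j"
  shows "q powi j < 1"
  using assms by (simp add: power_int_def power_less_one_iff)

text \<open>By the ultrametric inequality it is enough to bound the two terms of each entry. On the
  diagonal one of them is a product of off-diagonal entries, integral because \<open>n - m\<close>
  is nonnegative.\<close>

lemma seg_order_mult:
  fixes A B :: "'k::nonarch_local_field ^ 2 ^ 2"
  assumes "m \<le> n" "A \<in> seg_order {m..n}" "B \<in> seg_order {m..n}"
  shows "A ** B \<in> seg_order {m..n}"
proof -
  obtain t :: 'k where t: "uniformizer t"
    using uniformizer_exists by blast
  let ?q = "dist 0 t"
  note q = uniformizer_bounds[OF t]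
  have AB: "dist 0 (A $ 1 $ 1) \<le> 1" "dist 0 (A $ 1 $ 2) \<le> ?q powi (- m)" "dist 0 (A $ 2 $ 1) \<le> ?q powi n"
    "dist 0 (A $ 2 $ 2) \<le> 1" "dist 0 (B $ 1 $ 1) \<le> 1" "dist 0 (B $ 1 $ 2) \<le> ?q powi (- m)"
    "dist 0 (B $ 2 $ 1) \<le> ?q powi n" "dist 0 (B $ 2 $ 2) \<le> 1"
    using assms by (auto simp: seg_order_eq[OF t])
  have le: "?q powi (n - m) \<le> 1"
    using q assms(1) by (intro powi_le_one) auto
  have sum: "dist 0 (x * y + z * w) \<le> r"
    if "dist 0 x * dist 0 y \<le> r" "dist 0 z * dist 0 w \<le> r" for x y z w :: 'k and r
    using dist_zero_add_le[of "x * y" "z * w"] that by (simp add: dist_zero_mult)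
  have scale: "x * y \<le> r" "y * x \<le> r" if "x \<le> 1" "y \<le> r" "0 \<le> x" "0 \<le> y" for x y r :: real
    using mult_mono[of x 1 y r] that by (auto simp: mult.commute)
  show ?thesis
    unfolding seg_order_eq[OF t assms(1)] mem_Collect_eq matrix_matrix_mult_2
    using AB off_diagonal_le[OF t AB(2,7)] off_diagonal_le[OF t AB(6,3)] le
    by (intro conjI sum) (auto intro: scale simp: mult.commute)
qed

lemma mat_one_mem_seg_order:
  assumes "m \<le> n"
  shows "(mat 1 :: 'k::nonarch_local_field ^ 2 ^ 2) \<in> seg_order {m..n}"
proof -
  obtain t :: 'k where t: "uniformizer t"
    using uniformizer_exists by blast
  show ?thesis
    by (simp add: seg_order_eq[OF t assms])
qed

text \<open>Determinants on the order are integral, so those of a unit and of its inverse are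
  integral with product 1. Conversely, if the determinant is a unit, the adjugate formula only swaps
  the absolute values on the diagonal and keeps the others, so the inverse stays in the
  order.\<close>

lemma seg_order_units_eq:
  assumes "m \<le> n"
  shows "seg_order_units {m..n} = {A \<in> seg_order {m..n}. dist 0 (det A) = 1}"
proof (intro equalityI subsetI)
  obtain t :: 'a where t: "uniformizer t"
    using uniformizer_exists by blast
  note q = uniformizer_bounds[OF t] and order = seg_order_eq[OF t assms]
  have le: "dist 0 (det A) \<le> 1" if "A \<in> seg_order {m..n}" for A :: "'a ^ 2 ^ 2"
  proof -
    have "dist 0 (A $ 1 $ 1) * dist 0 (A $ 2 $ 2) \<le> 1"
      using that by (simp add: order mult_le_one)
    moreover have "dist 0 (A $ 1 $ 2) * dist 0 (A $ 2 $ 1) \<le> 1"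
      using off_diagonal_le[OF t, of "A $ 1 $ 2" m "A $ 2 $ 1" n] that powi_le_one[OF q, of "n - m"] assms
      by (simp add: order)
    ultimately show ?thesis
      using dist_zero_det_le[of A] by simp
  qed
  fix A :: "'a ^ 2 ^ 2"
  {
    assume "A \<in> seg_order_units {m..n}"
    then obtain B where B: "A \<in> seg_order {m..n}" "B \<in> seg_order {m..n}" "A ** B = mat 1"
      by (auto simp: seg_order_units_def)
    have "dist 0 (det A) * dist 0 (det B) = 1"
      using B(3) by (metis det_I det_mul dist_zero_mult dist_zero_one)
    then have "dist 0 (det A) = 1"
      using le[OF B(1)] le[OF B(2)] mult_le_one[of "dist 0 (det A)" "dist 0 (det B)"]
      by (smt (verit) mult_left_le zero_le_dist)
    then show "A \<in> {A \<in> seg_order {m..n}. dist 0 (det A) = 1}"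
      using B by simp
  next
    assume A: "A \<in> {A \<in> seg_order {m..n}. dist 0 (det A) = 1}"
    then have "det A \<noteq> 0"
      by auto
    moreover have "matrix_2 (A $ 2 $ 2 / det A) (- A $ 1 $ 2 / det A) (- A $ 2 $ 1 / det A) (A $ 1 $ 1 / det A)
      \<in> seg_order {m..n}"
      using A by (simp add: order dist_zero_divide)
    ultimately show "A \<in> seg_order_units {m..n}"
      using A matrix_2_inverse[of A] unfolding seg_order_units_def by blast
  }
qed

section \<open>Topology of the unit groups\<close>

text \<open>The conditions on the entries are closed balls, which are open here, and so is the unit
  sphere, which contains the determinant.\<close>

lemma open_seg_order_units:
  assumes "m \<le> n"
  shows "open (seg_order_units {m..n} :: ('k::nonarch_local_field ^ 2 ^ 2) set)"
proof -
  obtain t :: 'k where t: "uniformizer t"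
    using uniformizer_exists by blast
  note q = uniformizer_bounds[OF t]
  have "open {A :: 'k ^ 2 ^ 2. A $ i $ j \<in> {x. dist 0 x \<le> r}}" if "r > 0" for i j r
    using open_vimage[OF open_dist_le[OF that, of 0], of "\<lambda>A :: 'k ^ 2 ^ 2. A $ i $ j"]
    by (simp add: vimage_def continuous_intros)
  then have entry: "open {A :: 'k ^ 2 ^ 2. dist 0 (A $ i $ j) \<le> r}" if "r > 0" for i j r
    using that by simp
  have "{x :: 'k. dist 0 x = 1} = - {x. dist 0 x < 1} \<inter> {x. dist 0 x \<le> 1}"
    by auto
  then have unit: "open {x :: 'k. dist 0 x = 1}"
    using open_dist_le[of 1 "0 :: 'k"] closed_dist_less[of 1 "0 :: 'k"] by (simp add: open_Int open_Compl)
  have "open {A :: 'k ^ 2 ^ 2. dist 0 (det A) = 1}"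
    using open_vimage[OF unit, of "det :: 'k ^ 2 ^ 2 \<Rightarrow> 'k"]
    by (simp add: vimage_def continuous_intros)
  then show ?thesis
    unfolding seg_order_units_eq[OF assms] seg_order_eq[OF t assms] Collect_conj_eq Collect_mem_eq
    using q by (intro open_Int entry) auto
qed

text \<open>The order is a continuous image of a product of four compact balls, and the condition on
  the determinant is closed.\<close>

lemma compact_seg_order_units:
  assumes "m \<le> n"
  shows "compact (seg_order_units {m..n} :: ('k::nonarch_local_field ^ 2 ^ 2) set)"
proof -
  obtain t :: 'k where t: "uniformizer t"
    using uniformizer_exists by blast
  let ?D = "\<lambda>r. {x :: 'k. dist 0 x \<le> r}" and ?q = "dist 0 t"
  let ?M = "\<lambda>p. matrix_2 (fst p) (fst (snd p)) (fst (snd (snd p))) (snd (snd (snd p))) :: 'k ^ 2 ^ 2"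
  let ?P = "?D 1 \<times> ?D (?q powi (- m)) \<times> ?D (?q powi n) \<times> ?D 1"
  have "continuous_on S (\<lambda>p. ?M p $ i $ j)" for S i j
    by (cases "i = 1"; cases "j = 1") (auto simp: matrix_2_def intro!: continuous_intros)
  then have "continuous_on ?P (\<lambda>p. \<chi> i j. ?M p $ i $ j)"
    by (intro continuous_on_vec_lambda)
  then have "continuous_on ?P ?M"
    by simp
  then have "compact (?M ` ?P)"
    by (intro compact_continuous_image compact_Times compact_dist_zero_le)
  also have "?M ` ?P = seg_order {m..n}"
  proof (intro equalityI subsetI)
    fix A :: "'k ^ 2 ^ 2" assume "A \<in> seg_order {m..n}"
    then show "A \<in> ?M ` ?P"
      by (intro image_eqI[where x = "(A $ 1 $ 1, A $ 1 $ 2, A $ 2 $ 1, A $ 2 $ 2)"])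
        (auto simp: seg_order_eq[OF t assms] matrix_2_eq_iff)
  qed (auto simp: seg_order_eq[OF t assms])
  finally have "compact (seg_order {m..n} :: ('k ^ 2 ^ 2) set)" .
  moreover have "closed {A :: 'k ^ 2 ^ 2. dist 0 (det A) = 1}"
    by (intro closed_Collect_eq continuous_intros)
  ultimately have "compact (seg_order {m..n} \<inter> {A :: 'k ^ 2 ^ 2. dist 0 (det A) = 1})"
    by (rule compact_Int_closed)
  then show ?thesis
    by (simp add: seg_order_units_eq[OF assms] Collect_conj_eq)
qed

text \<open>Powers of a number below 1 decrease with the exponent, so a longer segment restricts the
  off-diagonal entries more.\<close>

lemma seg_order_antimono:
  assumes "segment l" "segment l'" "l' \<subseteq> l"
  shows "seg_order l \<subseteq> (seg_order l' :: ('k::nonarch_local_field ^ 2 ^ 2) set)"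
proof -
  obtain t :: 'k where t: "uniformizer t"
    using uniformizer_exists by blast
  note q = uniformizer_bounds[OF t]
  obtain m n m' n' where l: "m \<le> n" "l = {m..n}" "m' \<le> n'" "l' = {m'..n'}"
    using assms(1,2) unfolding segment_def by blast
  have "m \<le> m'" "n' \<le> n"
    using assms(3) l by auto
  then have "dist 0 t powi (- m) \<le> dist 0 t powi (- m')" "dist 0 t powi n \<le> dist 0 t powi n'"
    using q by (auto intro!: power_int_decreasing)
  then show ?thesis
    unfolding l(2,4) seg_order_eq[OF t l(1)] seg_order_eq[OF t l(3)] by auto
qed

subsection \<open>Averaging operators of segments\<close>

locale haar_smooth_representation = smooth_representation smul G \<pi>
  for smul :: "complex \<Rightarrow> 'v::ab_group_add \<Rightarrow> 'v"
    and G :: "('k::nonarch_local_field ^ 2 ^ 2) set"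
    and \<pi> :: "'k ^ 2 ^ 2 \<Rightarrow> 'v \<Rightarrow> 'v" +
  fixes \<mu> :: "('k ^ 2 ^ 2) measure"
  assumes subgroup_G: "subgroup G GL2"
    and closed_G: "closedin (top_of_set (carrier GL2)) G"
    and SL2_subset_G: "SL2 \<subseteq> G"
    and haar: "haar_measure G \<mu>"
begin

section \<open>The ambient group and its action\<close>

lemma one_mem_G: "mat 1 \<in> G"
  using subgroup.one_closed[OF subgroup_G] by (simp add: GL2_def)

lemma mult_mem_G: "A \<in> G \<Longrightarrow> B \<in> G \<Longrightarrow> A ** B \<in> G"
  using subgroup.m_closed[OF subgroup_G] by (simp add: GL2_def)

lemma inverse_mem_G:
  assumes "A \<in> G" "B ** A = mat 1" "A ** B = mat 1"
  shows "B \<in> G"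
proof -
  have "B \<in> carrier GL2"
    using assms(2,3) by (auto simp: GL2_def invertible_def)
  moreover have "A \<in> carrier GL2"
    using assms(1) subgroup.subset[OF subgroup_G] by blast
  ultimately have "inv\<^bsub>GL2\<^esub> A = B"
    using assms(2) by (intro group.inv_equality[OF group_GL2]) (auto simp: GL2_def)
  then show ?thesis
    using subgroup.m_inv_closed[OF subgroup_G assms(1)] by simp
qed

lemma inverse_in_G:
  assumes "A \<in> G"
  shows "\<exists>B\<in>G. A ** B = mat 1 \<and> B ** A = mat 1"
proof -
  have "invertible A"
    using assms subgroup.subset[OF subgroup_G] by (auto simp: GL2_def)
  then show ?thesis
    using inverse_mem_G[OF assms] unfolding invertible_def by blast
qed

lemma space_haar: "space \<mu> = G"
  using haar sets_eq_imp_space_eq[of \<mu> "restrict_space borel G"]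
  by (simp add: haar_measure_def space_restrict_space)

lemma openin_sets_haar:
  assumes "openin (top_of_set G) U"
  shows "U \<in> sets \<mu>"
proof -
  obtain T where "open T" "U = G \<inter> T"
    using assms by (auto simp: openin_open)
  then show ?thesis
    using haar by (auto simp: haar_measure_def sets_restrict_space)
qed

text \<open>A nonempty fibre is a left translate of the stabiliser of \<open>v\<close>, which is
  open by smoothness; it is obtained as a preimage under multiplication by the inverse
  matrix.\<close>

lemma open_fibre: "openin (top_of_set G) {g \<in> G. \<pi> g v = u}"
proof (cases "\<exists>g0\<in>G. u = \<pi> g0 v")
  case True
  then obtain A B where A: "A \<in> G" "u = \<pi> A v" "B \<in> G" "A ** B = mat 1" "B ** A = mat 1"
    using inverse_in_G by blast
  have "\<pi> g v = u \<longleftrightarrow> \<pi> (B ** g) v = v" if g: "g \<in> G" for g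
  proof -
    have "\<pi> g v = \<pi> A (\<pi> B (\<pi> g v))"
      using A(4) rep_one rep_mult[OF A(1,3)] by metis
    moreover have "v = \<pi> B (\<pi> A v)"
      using A(5) rep_one rep_mult[OF A(3,1)] by metis
    ultimately show ?thesis
      using rep_mult[OF A(3) g] A(2) by metis
  qed
  then have *: "{g \<in> G. \<pi> g v = u} = G \<inter> (\<lambda>g. B ** g) -` {g \<in> G. \<pi> g v = v}"
    using mult_mem_G[OF A(3)] by auto
  have "continuous_on G (\<lambda>g. B ** g)"
    by (intro continuous_intros)
  then show ?thesis
    unfolding * using mult_mem_G[OF A(3)] rep_smooth by (intro continuous_openin_preimage[of G _ G]) auto
next
  case False
  then have "{g \<in> G. \<pi> g v = u} = {}"
    by blast
  then show ?thesis
    by (simp only: openin_empty)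
qed

section \<open>Compact open groups attached to segments\<close>

lemma seg_group_subset_G: "seg_group G l \<subseteq> G"
  by (simp add: seg_group_def)

lemma seg_group_mem_G: "A \<in> seg_group G l \<Longrightarrow> A \<in> G"
  by (simp add: seg_group_def)

lemma seg_group_eq:
  assumes "m \<le> n"
  shows "seg_group G {m..n} = {A \<in> seg_order {m..n}. dist 0 (det A) = 1 \<and> A \<in> G}"
  by (auto simp: seg_group_def seg_order_units_eq[OF assms])

lemma open_seg_group:
  assumes "m \<le> n"
  shows "openin (top_of_set G) (seg_group G {m..n})"
  using open_seg_order_units[OF assms] unfolding seg_group_def openin_open by blast

text \<open>\<open>G\<close> is closed relative to the invertible matrices. All units of the order
  are invertible, so the group is a compact set cut by a closed set of matrices.\<close>

lemma compact_seg_group: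
  assumes "m \<le> n"
  shows "compact (seg_group G {m..n})"
proof -
  obtain T where T: "closed T" "G = carrier GL2 \<inter> T"
    using closed_G by (auto simp: closedin_closed)
  have "seg_order_units {m..n} \<subseteq> carrier GL2"
    by (auto simp: seg_order_units_def GL2_def invertible_def)
  then have "seg_group G {m..n} = seg_order_units {m..n} \<inter> T"
    using T(2) by (auto simp: seg_group_def)
  then show ?thesis
    using compact_Int_closed[OF compact_seg_order_units[OF assms] T(1)] by simp
qed

lemma one_mem_seg_group: "m \<le> n \<Longrightarrow> mat 1 \<in> seg_group G {m..n}"
  by (simp add: seg_group_eq mat_one_mem_seg_order one_mem_G)

lemma mult_mem_seg_group:
  assumes "m \<le> n" "A \<in> seg_group G {m..n}" "B \<in> seg_group G {m..n}"
  shows "A ** B \<in> seg_group G {m..n}"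
  using assms by (auto simp: seg_group_eq seg_order_mult mult_mem_G det_mul dist_zero_mult)

lemma inverse_in_seg_group:
  assumes "A \<in> seg_group G {m..n}"
  shows "\<exists>B\<in>seg_group G {m..n}. A ** B = mat 1 \<and> B ** A = mat 1"
proof -
  obtain B where B: "B \<in> seg_order {m..n}" "A ** B = mat 1" "B ** A = mat 1"
    using assms by (auto simp: seg_group_def seg_order_units_def)
  then have "B \<in> G"
    using inverse_mem_G[of A B] assms seg_group_mem_G by simp
  moreover have "A \<in> seg_order {m..n}"
    using assms by (simp add: seg_group_def seg_order_units_def)
  ultimately show ?thesis
    using B by (intro bexI[of _ B]) (auto simp: seg_group_def seg_order_units_def)
qed

lemma seg_group_antimono:
  assumes "segment l" "segment l'" "l' \<subseteq> l"
  shows "seg_group G l \<subseteq> seg_group G l'"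
proof
  fix A assume A: "A \<in> seg_group G l"
  then obtain B where "B \<in> seg_order l" "A ** B = mat 1" "B ** A = mat 1"
    by (auto simp: seg_group_def seg_order_units_def)
  moreover have "A \<in> seg_order l" "A \<in> G"
    using A by (simp_all add: seg_group_def seg_order_units_def)
  ultimately show "A \<in> seg_group G l'"
    using seg_order_antimono[OF assms] by (auto simp: seg_group_def seg_order_units_def)
qed

section \<open>Finite orbits and integrals\<close>

text \<open>The fibres of \<open>g \<mapsto> \<pi> g v\<close> are an open cover of a compact group;
  finitely many suffice, so finitely many values occur.\<close>

lemma finite_orbit_seg_group:
  assumes "m \<le> n"
  shows "finite (orbit (\<pi> ` seg_group G {m..n}) v)"
proof -
  let ?K = "seg_group G {m..n}"
  let ?F = "\<lambda>u. {g \<in> ?K. \<pi> g v = u}"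
  have "openin (top_of_set ?K) (?F u)" for u
  proof -
    have "?F u = ?K \<inter> {g \<in> G. \<pi> g v = u}"
      using seg_group_subset_G by auto
    then have "openin (top_of_set G) (?F u)"
      using openin_Int[OF open_seg_group[OF assms] open_fibre[of v u]] by (simp only:)
    then show ?thesis
      by (rule openin_subset_trans) (use seg_group_subset_G in auto)
  qed
  then have "\<forall>c\<in>range ?F. openin (top_of_set ?K) c" "?K \<subseteq> \<Union>(range ?F)"
    by auto
  then obtain D where D: "D \<subseteq> range ?F" "finite D" "?K \<subseteq> \<Union>D"
    using compact_seg_group[OF assms] unfolding compact_eq_openin_cover by meson
  obtain W where W: "finite W" "D = ?F ` W"
    using finite_subset_image[OF D(2,1)] by blast
  have "orbit (\<pi> ` ?K) v \<subseteq> W"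
    using D(3) unfolding W(2) orbit_def by blast
  then show ?thesis
    using W(1) finite_subset by blast
qed

lemma finite_orbit_group_seg_group:
  assumes "m \<le> n"
  shows "finite_orbit_group smul (\<pi> ` seg_group G {m..n})"
proof (intro finite_orbit_group.intro vector_space_axioms finite_orbit_group_axioms.intro)
  let ?K = "seg_group G {m..n}"
  have comp: "\<pi> A \<circ> \<pi> B = \<pi> (A ** B)" if "A \<in> ?K" "B \<in> ?K" for A B
    using that by (simp add: fun_eq_iff rep_mult seg_group_mem_G)
  have one: "\<pi> (mat 1) = id"
    using rep_one by auto
  show "id \<in> \<pi> ` ?K"
    using one_mem_seg_group[OF assms] one by (metis imageI)
  show "finite (orbit (\<pi> ` ?K) v)" for v
    by (rule finite_orbit_seg_group[OF assms])
  fix h assume "h \<in> \<pi> ` ?K"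
  then obtain A where A: "A \<in> ?K" "h = \<pi> A"
    by blast
  show "Vector_Spaces.linear smul smul h"
    using A rep_linear seg_group_subset_G by blast
  obtain B where B: "B \<in> ?K" "A ** B = mat 1" "B ** A = mat 1"
    using inverse_in_seg_group[OF A(1)] by blast
  then have "\<pi> B \<circ> h = id" "h \<circ> \<pi> B = id"
    using A comp one by simp_all
  then show "\<exists>h'\<in>\<pi> ` ?K. h' \<circ> h = id \<and> h \<circ> h' = id"
    using B(1) by blast
  fix h' assume "h' \<in> \<pi> ` ?K"
  then obtain B where B: "B \<in> ?K" "h' = \<pi> B"
    by blast
  show "h \<circ> h' \<in> \<pi> ` ?K"
    unfolding A(2) B(2) comp[OF A(1) B(1)] by (intro imageI mult_mem_seg_group[OF assms] A B)
qed

text \<open>By left invariance, the fibres of \<open>g \<mapsto> \<pi> g v\<close> on the compact open subgroup all have the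
  same measure, so that the integral is a plain average over the orbit.\<close>

lemma seg_average_eq_orbit_average:
  assumes "m \<le> n"
  shows "seg_average smul G \<mu> \<pi> {m..n} = orbit_average smul (\<pi> ` seg_group G {m..n})"
proof
  fix v
  let ?K = "seg_group G {m..n}"
  let ?O = "orbit (\<pi> ` ?K) v"
  interpret K: finite_orbit_group smul "\<pi> ` ?K"
    by (rule finite_orbit_group_seg_group[OF assms])
  interpret avg: Vector_Spaces.linear smul smul K.avg
    by (rule K.linear_avg)
  define fib where "fib u = {g \<in> ?K. \<pi> g v = u}" for u
  define c where "c = inverse (complex_of_real (measure \<mu> ?K))"
  let ?F = "\<lambda>g. smul (c * indicator ?K g) (\<pi> g v)"
  have fib_sets: "fib u \<in> sets \<mu>" for u
  proof -
    have "fib u = ?K \<inter> {g \<in> G. \<pi> g v = u}"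
      using seg_group_subset_G by (auto simp: fib_def)
    then show ?thesis
      using open_seg_group[OF assms] open_fibre[of v u] by (simp only: openin_sets_haar openin_Int)
  qed
  have K_sets: "?K \<in> sets \<mu>"
    using open_seg_group[OF assms] by (rule openin_sets_haar)
  \<comment> \<open>The real-valued \<open>measure\<close> is 0 on sets of infinite mass, so
    \<open>c\<close> is nonzero only if the mass is both finite (compactness) and positive
    (openness).\<close>
  have fin: "emeasure \<mu> ?K \<noteq> \<infinity>"
    using haar compact_seg_group[OF assms] seg_group_subset_G unfolding haar_measure_def
    by (metis order_less_irrefl)
  have "0 < emeasure \<mu> ?K"
    using haar open_seg_group[OF assms] one_mem_seg_group[OF assms] unfolding haar_measure_def by blast
  then have pos: "measure \<mu> ?K \<noteq> 0"
    using fin by (simp add: measure_def enn2real_eq_0_iff)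
  then have c: "c \<noteq> 0"
    by (simp add: c_def)
  have fib_measure: "measure \<mu> (fib u) = measure \<mu> (fib v)" if u: "u \<in> ?O" for u
  proof -
    obtain A where A: "A \<in> ?K" "u = \<pi> A v"
      using u by (auto simp: orbit_def)
    obtain B where B: "B \<in> ?K" "A ** B = mat 1" "B ** A = mat 1"
      using inverse_in_seg_group[OF A(1)] by blast
    note G = A(1)[THEN seg_group_mem_G] B(1)[THEN seg_group_mem_G]
    \<comment> \<open>Left multiplication by \<open>A\<close> carries the stabiliser of
      \<open>v\<close> in the group onto the fibre over \<open>u = \<pi> A v\<close>.\<close>
    have "fib u = (\<lambda>h. A ** h) ` fib v"
    proof (intro equalityI subsetI)
      fix g assume g: "g \<in> fib u"
      have "g = A ** (B ** g)"
        by (simp add: matrix_mul_assoc B)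
      moreover have "\<pi> (B ** g) v = \<pi> B (\<pi> A v)"
        using g G A(2) by (auto simp: fib_def rep_mult seg_group_mem_G)
      then have "\<pi> (B ** g) v = v"
        using rep_mult[OF G(2,1)] B(3) rep_one by metis
      ultimately show "g \<in> (\<lambda>h. A ** h) ` fib v"
        using g mult_mem_seg_group[OF assms B(1)] by (auto simp: fib_def)
    next
      fix g assume "g \<in> (\<lambda>h. A ** h) ` fib v"
      then show "g \<in> fib u"
        using mult_mem_seg_group[OF assms A(1)] G(1) A(2)
        by (auto simp: fib_def rep_mult seg_group_mem_G)
    qed
    then show ?thesis
      using haar G(1) fib_sets[of v] by (simp add: haar_measure_def measure_def)
  qed
  have K_Un: "?K = (\<Union>u\<in>?O. fib u)"
    by (auto simp: fib_def orbit_def)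
  have "emeasure \<mu> (fib u) \<noteq> \<infinity>" for u
    using emeasure_mono[of "fib u" ?K \<mu>] K_sets fin by (auto simp: fib_def top_unique)
  then have "measure \<mu> (\<Union>u\<in>?O. fib u) = (\<Sum>u\<in>?O. measure \<mu> (fib u))"
    using K.finite_orbit fib_sets
    by (intro measure_finite_Union) (auto simp: disjoint_family_on_def fib_def)
  then have "measure \<mu> ?K = (\<Sum>u\<in>?O. measure \<mu> (fib u))"
    by (rule trans[OF arg_cong[OF K_Un]])
  then have K_measure: "measure \<mu> ?K = card ?O * measure \<mu> (fib v)"
    using fib_measure by simp
  have integral: "seg_average smul G \<mu> \<pi> {m..n} v = (\<Sum>w\<in>?F ` space \<mu> - {0}.
      smul (complex_of_real (measure \<mu> {g \<in> space \<mu>. ?F g = w})) w)"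
    by (simp add: seg_average_def rep_operator_def lc_integral_def flip: c_def)
  \<comment> \<open>The integral sums over nonzero values only. For \<open>v = 0\<close> there are
    none; otherwise they form exactly the orbit scaled by \<open>c\<close>, since the operators are
    injective and the integrand vanishes off the group.\<close>
  show "seg_average smul G \<mu> \<pi> {m..n} v = K.avg v"
  proof (cases "v = 0")
    case True
    have "?F g = 0" if "g \<in> G" for g
      using rep_linear[OF that] True
      by (simp add: module_hom.zero Vector_Spaces.linear.axioms linear_iff_module_hom)
    then have "?F ` space \<mu> - {0} = {}"
      by (auto simp: space_haar)
    then have "seg_average smul G \<mu> \<pi> {m..n} v = 0"
      unfolding integral by (simp only: sum.empty)
    then show ?thesis
      using avg.zero True by simp
  next
    case False
    have nz: "u \<noteq> 0" if u: "u \<in> ?O" for u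
    proof
      assume "u = 0"
      then have "0 \<in> ?O"
        using u by simp
      then obtain h where h: "h \<in> \<pi> ` ?K" "h v = 0"
        unfolding orbit_def by (metis imageE)
      then have "h v = h 0"
        using K.H_linear[OF h(1)] by (simp add: module_hom.zero linear_iff_module_hom)
      then show False
        using K.inj_H[OF h(1)] False by (simp add: inj_eq)
    qed
    have img: "?F ` space \<mu> - {0} = smul c ` ?O"
    proof (intro equalityI subsetI)
      fix w assume "w \<in> ?F ` space \<mu> - {0}"
      then obtain g where "g \<in> ?K" "w = smul c (\<pi> g v)"
        by (auto simp: indicator_def split: if_splits)
      then show "w \<in> smul c ` ?O"
        by (auto simp: orbit_def)
    next
      fix w assume "w \<in> smul c ` ?O"
      then obtain g where g: "g \<in> ?K" "w = smul c (\<pi> g v)"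
        by (auto simp: orbit_def)
      then have "w \<noteq> 0"
        using c nz[of "\<pi> g v"] by (auto simp: orbit_def)
      moreover have "w = ?F g" "g \<in> space \<mu>"
        using g seg_group_subset_G by (auto simp: space_haar)
      ultimately show "w \<in> ?F ` space \<mu> - {0}"
        by blast
    qed
    have fib_F: "{g \<in> space \<mu>. ?F g = smul c u} = fib u" if "u \<in> ?O" for u
      using c nz[OF that] seg_group_subset_G
      by (auto simp: fib_def space_haar indicator_def split: if_splits)
    have "seg_average smul G \<mu> \<pi> {m..n} v
        = (\<Sum>w\<in>smul c ` ?O. smul (complex_of_real (measure \<mu> {g \<in> space \<mu>. ?F g = w})) w)"
      unfolding integral img ..
    also have "\<dots> = (\<Sum>u\<in>?O. smul (complex_of_real (measure \<mu> {g \<in> space \<mu>. ?F g = smul c u})) (smul c u))"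
      using c by (subst sum.reindex) (auto simp: inj_on_def)
    also have "\<dots> = (\<Sum>u\<in>?O. smul (complex_of_real (measure \<mu> (fib v)) * c) u)"
      using fib_measure by (intro sum.cong refl) (simp add: fib_F)
    also have "\<dots> = smul (complex_of_real (measure \<mu> (fib v)) * c) (\<Sum>?O)"
      by (simp add: scale_sum_right)
    \<comment> \<open>The total mass is the number of fibres times the mass of one, so the
      normalised weight of each value is the inverse of the orbit size.\<close>
    also have "complex_of_real (measure \<mu> (fib v)) * c = inverse (of_nat (card ?O))"
      using pos unfolding c_def K_measure by (simp add: field_simps)
    finally show ?thesis
      by (simp add: orbit_average_def)
  qed
qed

section \<open>Factorization of the group of the inner segment\<close>

text \<open>Once \<open>d\<close> is a unit, column operations are replaced by one explicit
  unipotent factor \<open>U\<close>. It has determinant 1 and so lies in \<open>G\<close>, which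
  forces the lower triangular factor \<open>L\<close> into \<open>G\<close> as well.\<close>

lemma seg_group_factorization:
  assumes "m + 3 \<le> n" "A \<in> seg_group G {m + 1..n - 1}"
  shows "\<exists>U\<in>seg_group G {m + 1..n}. \<exists>L\<in>seg_group G {m..n - 1}. A = U ** L"
proof -
  obtain t :: 'k where t: "uniformizer t"
    using uniformizer_exists by blast
  note q = uniformizer_bounds[OF t]
  have le: "m + 1 \<le> n - 1" "m + 1 \<le> n" "m \<le> n - 1"
    using assms(1) by auto
  note order = le[THEN seg_order_eq[OF t]]
  define a b c d where "a = A $ 1 $ 1" "b = A $ 1 $ 2" "c = A $ 2 $ 1" "d = A $ 2 $ 2"
  note abcd = this
  have A: "dist 0 a \<le> 1" "dist 0 b \<le> dist 0 t powi (- (m + 1))" "dist 0 c \<le> dist 0 t powi (n - 1)"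
    "dist 0 d \<le> 1" "dist 0 (a * d - b * c) = 1" "A \<in> G"
    using assms(2) unfolding seg_group_eq[OF le(1)] order abcd by (auto simp: det_2)
  \<comment> \<open>The exponent is \<open>n - m - 2\<close>; the bound \<open>m + 3 \<le> n\<close>
    makes it positive and the inequality strict.\<close>
  have bc: "dist 0 (b * c) < 1"
    using off_diagonal_le[OF t A(2,3)] powi_less_one[OF q, of "n - 1 - (m + 1)"] assms(1)
    by (simp add: dist_zero_mult)
  \<comment> \<open>The determinant has absolute value 1 and \<open>b * c\<close> is smaller, so
    \<open>a * d\<close> must account for it.\<close>
  have "1 \<le> dist 0 a * dist 0 d"
    using dist_zero_diff_le[of "a * d" "b * c"] bc A(5) by (simp add: dist_zero_mult)
  then have d: "dist 0 d = 1"
    using A(1,4) mult_right_mono[OF A(1), of "dist 0 d"] by simp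
  then have d_nz: "d \<noteq> 0"
    by auto
  define U where "U = matrix_2 1 (b / d) 0 1"
  define V where "V = matrix_2 1 (- b / d) 0 1"
  define L where "L = matrix_2 (a - b * c / d) 0 c d"
  have "U \<in> SL2" "V \<in> SL2"
    by (simp_all add: SL2_def U_def V_def det_2)
  then have UV: "U \<in> G" "V \<in> G"
    using SL2_subset_G by auto
  have UL: "A = U ** L" and VA: "L = V ** A"
    using d_nz by (simp_all add: matrix_2_eq_iff matrix_matrix_mult_2 U_def V_def L_def abcd)
  have "dist 0 (a - b * c / d) \<le> 1"
    using dist_zero_diff_le[of a "b * c / d"] A(1) bc d by (simp add: dist_zero_divide)
  \<comment> \<open>The upper right entry of \<open>L\<close> is 0, so the stricter bound at the
    endpoint \<open>m\<close> holds; likewise for the lower left entry of \<open>U\<close> at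
    \<open>n\<close>.\<close>
  then have "L \<in> seg_order {m..n - 1}"
    using A q unfolding order by (simp add: L_def)
  moreover have "det L = a * d - b * c"
    using d_nz by (simp add: det_2 L_def field_simps)
  moreover have "L \<in> G"
    using VA UV(2) A(6) mult_mem_G by simp
  ultimately have "L \<in> seg_group G {m..n - 1}"
    unfolding seg_group_eq[OF le(3)] using A(5) by simp
  moreover have "U \<in> seg_order {m + 1..n}"
    using A(2) q d unfolding order by (simp add: U_def dist_zero_divide)
  then have "U \<in> seg_group G {m + 1..n}"
    unfolding seg_group_eq[OF le(2)] using UV(1) by (simp add: U_def det_2)
  ultimately show ?thesis
    using UL by blast
qed

text \<open>Factor the inverse of \<open>A\<close> and invert the product, which reverses the order
  of the factors.\<close>

lemma seg_group_factorization':
  assumes "m + 3 \<le> n" "A \<in> seg_group G {m + 1..n - 1}"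
  shows "\<exists>L\<in>seg_group G {m..n - 1}. \<exists>U\<in>seg_group G {m + 1..n}. A = L ** U"
proof -
  obtain B where B: "B \<in> seg_group G {m + 1..n - 1}" "A ** B = mat 1" "B ** A = mat 1"
    using inverse_in_seg_group[OF assms(2)] by blast
  obtain U L where UL: "U \<in> seg_group G {m + 1..n}" "L \<in> seg_group G {m..n - 1}" "B = U ** L"
    using seg_group_factorization[OF assms(1) B(1)] by blast
  obtain U' L' where UL': "U' \<in> seg_group G {m + 1..n}" "L' \<in> seg_group G {m..n - 1}"
    "U' ** U = mat 1" "L' ** L = mat 1"
    using inverse_in_seg_group UL(1,2) by meson
  have "(L' ** U') ** (U ** L) = mat 1"
    using UL'(3,4) by (metis matrix_mul_assoc matrix_mul_lid)
  then have "L' ** U' = A"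
    using B(2) UL(3)
    by (metis B(3) matrix_left_right_inverse matrix_mul_assoc matrix_mul_lid matrix_mul_rid)
  then show ?thesis
    using UL' by blast
qed

end

section \<open>Commuting averages and the standard projector\<close>

theorem theorem4:
  fixes G :: "('k::nonarch_local_field ^ 2 ^ 2) set"
    and \<mu> :: "('k ^ 2 ^ 2) measure"
    and smul :: "complex \<Rightarrow> 'v::ab_group_add \<Rightarrow> 'v"
    and \<pi> :: "'k ^ 2 ^ 2 \<Rightarrow> 'v \<Rightarrow> 'v"
    and m n :: int
  assumes "subgroup G GL2"
    and "closedin (top_of_set (carrier GL2)) G"
    and "SL2 \<subseteq> G"
    and "haar_measure G \<mu>"
    and "smooth_representation smul G \<pi>"
    and "m \<le> n"
    and "\<bar>m - n\<bar> \<ge> 3"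
  shows "standard_projector smul G \<mu> \<pi> {m..n}
    (\<lambda>v. seg_average smul G \<mu> \<pi> {m..n} v
        - seg_average smul G \<mu> \<pi> {m + 1..n} v
        - seg_average smul G \<mu> \<pi> {m..n - 1} v
        + seg_average smul G \<mu> \<pi> {m + 1..n - 1} v)"
proof -
  interpret smooth_representation smul G \<pi>
    by fact
  interpret haar_smooth_representation smul G \<pi> \<mu>
    by (intro haar_smooth_representation.intro haar_smooth_representation_axioms.intro assms)
  have mn: "m + 3 \<le> n" "m + 1 \<le> n - 1" "m + 1 \<le> n" "m \<le> n - 1"
    using assms(6,7) by auto
  let ?H = "\<lambda>l. \<pi> ` seg_group G l" and ?e = "seg_average smul G \<mu> \<pi>"
  have seg: "segment {i..j}" if "i \<le> j" for i j
    using that by (auto simp: segment_def)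
  have group: "finite_orbit_group smul (?H l)" and e: "?e l = orbit_average smul (?H l)"
    if "segment l" for l
    using that finite_orbit_group_seg_group seg_average_eq_orbit_average unfolding segment_def by blast+
  have sub: "?H l \<subseteq> ?H l'" if "segment l" "segment l'" "l' \<subseteq> l" for l l'
    using seg_group_antimono[OF that] by blast
  \<comment> \<open>The shorter segment \<open>l'\<close> has the larger group, so its average
    absorbs that of \<open>l\<close> on either side.\<close>
  have e_e: "?e l (?e l' v) = ?e l' v" "?e l' (?e l v) = ?e l' v"
    if "segment l" "segment l'" "l' \<subseteq> l" for l l' v
    using finite_orbit_group.avg_subgroup_avg[OF group[OF that(2)] group[OF that(1)] sub[OF that]]
    by (simp_all add: e that)
  have additive: "Modules.additive (?e l)" if "segment l" for l
    using finite_orbit_group.linear_avg[OF group[OF that]] unfolding e[OF that]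
    by (simp add: Modules.additive_def Vector_Spaces.linear_iff)
  have fixed: "v \<in> seg_fixed G \<pi> l \<longleftrightarrow> ?e l v = v" if "segment l" for l v
    using finite_orbit_group.avg_eq_self_iff[OF group[OF that]] by (simp add: e[OF that] seg_fixed_def)
  let ?l = "{m..n}" and ?A = "{m + 1..n}" and ?B = "{m..n - 1}" and ?C = "{m + 1..n - 1}"
  have segs: "segment ?l" "segment ?A" "segment ?B" "segment ?C"
    using mn assms(6) by (auto intro: seg)
  have sub_AC: "?H ?A \<subseteq> ?H ?C" and sub_BC: "?H ?B \<subseteq> ?H ?C"
    using sub[OF segs(2,4)] sub[OF segs(3,4)] by auto
  \<comment> \<open>The two orders of factorization give the two products; together they show that
    the averages for \<open>?A\<close> and \<open>?B\<close> commute.\<close>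
  have AB: "?e ?A (?e ?B v) = ?e ?C v" for v
    unfolding e[OF segs(2)] e[OF segs(3)] e[OF segs(4)]
  proof (rule finite_orbit_group.avg_avg_factorization)
    show "\<exists>a\<in>?H ?A. \<exists>b\<in>?H ?B. h = a \<circ> b" if h: "h \<in> ?H ?C" for h
    proof -
      obtain g where "g \<in> seg_group G ?C" "h = \<pi> g"
        using h by blast
      then obtain a b where "a \<in> seg_group G ?A" "b \<in> seg_group G ?B" "h = \<pi> (a ** b)"
        using seg_group_factorization[OF mn(1)] by blast
      moreover from this have "\<pi> (a ** b) = \<pi> a \<circ> \<pi> b"
        by (simp add: fun_eq_iff rep_mult seg_group_mem_G)
      ultimately show ?thesis
        by blast
    qed
  qed (rule group segs sub_AC sub_BC)+
  have BA: "?e ?B (?e ?A v) = ?e ?C v" for v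
    unfolding e[OF segs(2)] e[OF segs(3)] e[OF segs(4)]
  proof (rule finite_orbit_group.avg_avg_factorization)
    show "\<exists>b\<in>?H ?B. \<exists>a\<in>?H ?A. h = b \<circ> a" if h: "h \<in> ?H ?C" for h
    proof -
      obtain g where "g \<in> seg_group G ?C" "h = \<pi> g"
        using h by blast
      then obtain a b where "a \<in> seg_group G ?A" "b \<in> seg_group G ?B" "h = \<pi> (b ** a)"
        using seg_group_factorization'[OF mn(1)] by blast
      moreover from this have "\<pi> (b ** a) = \<pi> b \<circ> \<pi> a"
        by (simp add: fun_eq_iff rep_mult seg_group_mem_G)
      ultimately show ?thesis
        by blast
    qed
  qed (rule group segs sub_AC sub_BC)+
  have AB_proper: "?A \<in> proper_subsegments ?l" "?B \<in> proper_subsegments ?l" "?A \<noteq> ?B"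
    using segs assms(6) mn by (auto simp: proper_subsegments_def)
  have proper_cases: "segment l' \<and> (l' \<subseteq> ?A \<or> l' \<subseteq> ?B)" if l: "l' \<in> proper_subsegments ?l" for l'
  proof -
    obtain i j where l': "i \<le> j" "l' = {i..j}" "l' \<subset> ?l"
      using l by (auto simp: proper_subsegments_def segment_def)
    \<comment> \<open>A proper subsegment differs from \<open>?l\<close> in at least one endpoint,
      which decides whether \<open>?A\<close> or \<open>?B\<close> contains it.\<close>
    then have "m \<le> i" "j \<le> n" "i \<noteq> m \<or> j \<noteq> n"
      by auto
    then show ?thesis
      using l'(1,2) by (auto simp: segment_def)
  qed
  have zero: "?e l 0 = 0" if "segment l" for l
    using additive[OF that] by (rule Modules.additive.zero)
  \<comment> \<open>Vanishing for \<open>?A\<close> and \<open>?B\<close> is enough: if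
    \<open>l'\<close> lies in \<open>?A\<close>, then \<open>?e l' v = ?e l' (?e ?A v)\<close>, and
    similarly for \<open>?B\<close>.\<close>
  have sharp: "seg_sharp smul G \<mu> \<pi> ?l = {v. ?e ?l v = v \<and> ?e ?A v = 0 \<and> ?e ?B v = 0}"
  proof (intro equalityI subsetI)
    fix v assume "v \<in> {v. ?e ?l v = v \<and> ?e ?A v = 0 \<and> ?e ?B v = 0}"
    moreover have "?e l' v = 0" if "l' \<in> proper_subsegments ?l" "?e ?A v = 0" "?e ?B v = 0" for l'
      using proper_cases[OF that(1)] e_e(2)[OF segs(2), of l' v] e_e(2)[OF segs(3), of l' v] that zero
      by auto
    ultimately show "v \<in> seg_sharp smul G \<mu> \<pi> ?l"
      by (simp add: seg_sharp_def fixed[OF segs(1)])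
  qed (use AB_proper in \<open>auto simp: seg_sharp_def fixed[OF segs(1)]\<close>)
  have finite_proper: "finite (proper_subsegments ?l)"
    by (rule finite_subset[of _ "Pow ?l"]) (auto simp: proper_subsegments_def)
  have flat: "seg_flat G \<pi> ?l = {x + y | x y. ?e ?A x = x \<and> ?e ?B y = y}"
  proof (intro equalityI subsetI)
    fix v assume "v \<in> seg_flat G \<pi> ?l"
    then obtain x where x: "v = (\<Sum>l'\<in>proper_subsegments ?l. x l')"
      "\<And>l'. l' \<in> proper_subsegments ?l \<Longrightarrow> ?e l' (x l') = x l'"
      using proper_cases fixed by (auto simp: seg_flat_def)
    \<comment> \<open>The sum is split by containment in \<open>?A\<close>, so a segment contained
      in both is counted once; the segments left over lie in \<open>?B\<close>.\<close>
    let ?S = "{l' \<in> proper_subsegments ?l. l' \<subseteq> ?A}"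
    have "?e ?A (x l') = x l'" if "l' \<in> ?S" for l'
      using e_e(1)[OF segs(2), of l' "x l'"] that proper_cases x(2)[of l'] by auto
    then have "?e ?A (sum x ?S) = sum x ?S"
      by (simp add: Modules.additive.sum[OF additive[OF segs(2)]])
    moreover have "?e ?B (x l') = x l'" if "l' \<in> proper_subsegments ?l - ?S" for l'
      using e_e(1)[OF segs(3), of l' "x l'"] that proper_cases[of l'] x(2)[of l'] by auto
    then have "?e ?B (sum x (proper_subsegments ?l - ?S)) = sum x (proper_subsegments ?l - ?S)"
      by (simp add: Modules.additive.sum[OF additive[OF segs(3)]])
    moreover have "v = sum x ?S + sum x (proper_subsegments ?l - ?S)"
      unfolding x(1) using finite_proper
      by (subst add.commute) (intro sum.subset_diff, auto)
    ultimately show "v \<in> {x + y | x y. ?e ?A x = x \<and> ?e ?B y = y}"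
      by blast
  next
    fix v assume "v \<in> {x + y | x y. ?e ?A x = x \<and> ?e ?B y = y}"
    then obtain x y where xy: "v = x + y" "?e ?A x = x" "?e ?B y = y"
      by blast
    \<comment> \<open>The family is supported at \<open>?A\<close> and \<open>?B\<close>, which are
      distinct, so neither summand overwrites the other.\<close>
    define z where "z l' = (if l' = ?A then x else if l' = ?B then y else 0)" for l'
    have "(\<Sum>l'\<in>proper_subsegments ?l. z l') = (\<Sum>l'\<in>{?A, ?B}. z l')"
      using AB_proper by (intro sum.mono_neutral_right finite_proper) (auto simp: z_def)
    moreover have "sum z {a, b} = z a + z b" if "a \<noteq> b" for a b
      using that by simp
    moreover have "z ?A = x" "z ?B = y"
      using AB_proper(3) by (metis z_def)+
    ultimately have "v = (\<Sum>l'\<in>proper_subsegments ?l. z l')"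
      using AB_proper(3) xy(1) by metis
    moreover have "\<forall>l'\<in>proper_subsegments ?l. z l' \<in> seg_fixed G \<pi> l'"
      using xy fixed zero segs by (auto simp: z_def proper_subsegments_def)
    ultimately show "v \<in> seg_flat G \<pi> ?l"
      unfolding seg_flat_def by blast
  qed
  have le: "?A \<subseteq> ?l" "?B \<subseteq> ?l"
    by auto
  show ?thesis
    unfolding standard_projector_def sharp flat
    by (rule projector_of_commuting_idempotents)
      (simp_all add: additive segs e_e[OF segs(1) segs(2) le(1)] e_e[OF segs(1) segs(3) le(2)]
        e_e[OF segs(1) segs(1)] e_e[OF segs(2) segs(2)] e_e[OF segs(3) segs(3)] AB BA)
qed

end
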